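(* Let $R,Q$ be probability distributions on $\mathbb{R}$ with $Q\ll R$ and $\frac{dQ}{dR}(x)<\infty$ for all $x\in\mathbb{R}$, and let $c,c'\in(0,1)$ be fixed with $c\ne c'$. Let $t_n=\lfloor cn\rfloor$, $t_n'=\lfloor c'n\rfloor$. Let $\{X_{n,j}\}_{n\in\mathbb{N},1\le j\le n}$ be a triangular array whose $n$-th row has a changepoint $\tau_n$: $X_{n,1},\dots,X_{n,\tau_n}$ are i.i.d. from $R$, $X_{n,\tau_n+1},\dots,X_{n,n}$ are i.i.d. from $Q$, and these two blocks are independent. Consider the hypotheses $$\mathcal{H}_0^{(n)}:\tau_n=t_n,\qquad \mathcal{H}_1^{(n)}:\tau_n=t_n'.$$ Assume that, with $a$ the changepoint fraction ($a=c$ under $\mathcal{H}_0^{(n)}$, $a=c'$ under $\mathcal{H}_1^{(n)}$), there exists $\delta\in(0,1)$ such that: (i) the $\delta$-th quantile of $aR+(1-a)Q$ is unique (denote it $q_{\delta,a}$), and $R$ is continuous at $q_{\delta,a}$; (ii) $\mathbb{E}_{Z\sim Q}\left[\frac{dQ}{dR}(Z)\right]<\infty$ and $\mu\ne1$, where $$\mu=\frac{\frac{a}{\delta}R(q_{\delta,a})\,\mathbb{E}_{Z\sim R}\left[\frac{dQ}{dR}(Z)\right]+\left(1-\frac{a}{\delta}R(q_{\delta,a})\right)\mathbb{E}_{Z\sim Q}\left[\frac{dQ}{dR}(Z)\right]}{a\,\mathbb{E}_{Z\sim R}\left[\frac{dQ}{dR}(Z)\right]+(1-a)\,\mathbb{E}_{Z\sim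 Q}\left[\frac{dQ}{dR}(Z)\right]};$$ and moreover: (iii) for all $\delta'\in(0,1)$ the $\delta'$-th quantile of $aR+(1-a)Q$ is unique; (iv) $R,Q$ are absolutely continuous with respect to Lebesgue measure with continuous densities $r,q$, and $\mathbb{E}_{Z\sim Q}\left[\left(\frac{dQ}{dR}(Z)\right)^2\right]<\infty$, $\mathbb{E}_{Z\sim R}\left[\left(\frac{dQ}{dR}(Z)\right)^2\right]<\infty$. For $\alpha\in(0,1)$ define the test $$\phi_{n,\alpha}=\mathbf{1}\left(t_n\notin C^{\mathrm{MCP}}_{n,1-\alpha}\right)=\mathbf{1}\left(p^{\mathrm{CONF}}_{n,t_n}\le\alpha\right),$$ where $p^{\mathrm{CONF}}_{n,t}$ and $C^{\mathrm{MCP}}_{n,1-\alpha}$ are the $p$-values and confidence set produced by the MCP algorithm (with identity score) on $(X_{n,1},\dots,X_{n,n})$. Then: (i) $\phi_{n,\alpha}$ has level $\alpha$ for $\mathcal{H}_0^{(n)}$ for all $n$, i.e. $\mathbb{E}_{\mathcal{H}_0^{(n)}}[\phi_{n,\alpha}]\le\alpha$; (ii) $\{\phi_{n,\alpha}\}_n$ is consistent against $\{\mathcal{H}_1^{(n)}\}_n$, i.e. $\mathbb{E}_{\mathcal{H}_1^{(n)}}[\phi_{n,\alpha}]\to1$ as $n\to\infty$.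
   Context: The symbols $R,Q$ denote both distributions and their CDFs. $Q\ll R$ means absolute continuity and $\frac{dQ}{dR}$ is the Radon–Nikodym derivative. Only $n$ large enough that $t_n,t_n'\in\{1,\dots,n-1\}$ and $t_n\neq t_n'$ are considered. MCP algorithm (identity score) on data $X_{n,1},\dots,X_{n,n}$. Draw independent $\theta^{(t)}_{n,r}\sim U(0,1)$ ($t\in\{1,\dots,n-1\}$, $r\in\{1,\dots,n\}$), independent of the data. For each $t\in\{1,\dots,n-1\}$: for $r=1,\dots,t$ set $p^{(t)}_{n,r}=\frac1r\sum_{j=1}^r\left(\mathbf{1}(X_{n,j}>X_{n,r})+\theta^{(t)}_{n,r}\mathbf{1}(X_{n,j}=X_{n,r})\right)$; for $r=t+1,\dots,n$ set $p^{(t)}_{n,r}=\frac1{n-r+1}\sum_{j=r}^n\left(\mathbf{1}(X_{n,j}>X_{n,r})+\theta^{(t)}_{n,r}\mathbf{1}(X_{n,j}=X_{n,r})\right)$. Let $\widehat F^{(0)}_{n,t}(z)=\frac1t\sum_{r=1}^t\mathbf{1}(p^{(t)}_{n,r}\le z)$ and $\widehat F^{(1)}_{n,t}(z)=\frac1{n-t}\sum_{r=t+1}^n\mathbf{1}(p^{(t)}_{n,r}\le z)$. For a CDF $G$ let $\mathrm{KS}(G,u)=\sup_{z\in\mathbb{R}}|G(z)-U(z)|$, where $U$ is the CDF of the uniform distribution on $(0,1)$. Set $W^{(0)}_{n,t}=\sqrt t\,\mathrm{KS}(\widehat F^{(0)}_{n,t},u)$ and $W^{(1)}_{n,t}=\sqrt{n-t}\,\mathrm{KS}(\widehat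 F^{(1)}_{n,t},u)$. Let $F_m$ be the CDF of $\sqrt m\,\mathrm{KS}(\widehat F_m,u)$ where $\widehat F_m$ is the empirical CDF of $m$ i.i.d. $U(0,1)$ observations. Set $p^{\mathrm{left}}_{n,t}=1-F_t(W^{(0)}_{n,t})$, $p^{\mathrm{right}}_{n,t}=1-F_{n-t}(W^{(1)}_{n,t})$, $p^{\mathrm{CONF}}_{n,t}=\min\{2p^{\mathrm{left}}_{n,t},2p^{\mathrm{right}}_{n,t},1\}$ and $C^{\mathrm{MCP}}_{n,1-\alpha}=\{t\in\{1,\dots,n-1\}:p^{\mathrm{CONF}}_{n,t}>\alpha\}$. *)

theory Defs
  imports "HOL-Probability.Probability"
begin

definition mixture :: "real \<Rightarrow> real measure \<Rightarrow> real measure \<Rightarrow> real measure" where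
  "mixture a R Q = measure_of UNIV (sets borel)
     (\<lambda>A. ennreal a * emeasure R A + ennreal (1 - a) * emeasure Q A)"

lemma space_mixture [simp]: "space (mixture a R Q) = UNIV"
  by (simp add: mixture_def)

lemma sets_mixture [simp]: "sets (mixture a R Q) = sets borel"
  by (simp add: mixture_def sets.sigma_sets_eq[of borel, simplified])

lemma emeasure_mixture:
  assumes "sets R = sets borel" "sets Q = sets borel" "A \<in> sets borel"
  shows "emeasure (mixture a R Q) A = ennreal a * emeasure R A + ennreal (1 - a) * emeasure Q A"
proof (rule emeasure_measure_of[OF mixture_def])
  show "sets (borel :: real measure) \<subseteq> Pow UNIV" by simp
  show "A \<in> sets (mixture a R Q)" using assms by simp
  show "positive (sets (mixture a R Q)) (\<lambda>A. ennreal a * emeasure R A + ennreal (1 - a) * emeasure Q A)"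
    by (simp add: positive_def)
  show "countably_additive (sets (mixture a R Q))
      (\<lambda>A. ennreal a * emeasure R A + ennreal (1 - a) * emeasure Q A)"
    unfolding countably_additive_def
    using assms by (auto simp flip: suminf_add simp: suminf_emeasure image_subset_iff)
qed

text \<open>A level-\<open>\<delta>\<close> quantile is any \<open>x\<close> with \<open>P(Y \<le> x) \<ge> \<delta>\<close> and \<open>P(Y \<ge> x) \<ge> 1 - \<delta>\<close>;
  there may be a whole interval of them.\<close>

definition is_quantile :: "real measure \<Rightarrow> real \<Rightarrow> real \<Rightarrow> bool" where
  "is_quantile P \<delta> x \<longleftrightarrow> measure P {..x} \<ge> \<delta> \<and> measure P {x..} \<ge> 1 - \<delta>"

definition score_ratio ::
    "real measure \<Rightarrow> real measure \<Rightarrow> (real \<Rightarrow> real) \<Rightarrow> real \<Rightarrow> real \<Rightarrow> real \<Rightarrow> real" where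
  "score_ratio R Q w a \<delta> x =
     (a / \<delta> * cdf R x * (\<integral>z. w z \<partial>R) + (1 - a / \<delta> * cdf R x) * (\<integral>z. w z \<partial>Q)) /
     (a * (\<integral>z. w z \<partial>R) + (1 - a) * (\<integral>z. w z \<partial>Q))"

text \<open>Here \<open>f\<close> is a version of the Radon--Nikodym derivative \<open>dQ/dR\<close> and \<open>a\<close> the fraction of
  the data that precedes the changepoint.\<close>

definition changepoint_condition ::
    "real measure \<Rightarrow> real measure \<Rightarrow> (real \<Rightarrow> ennreal) \<Rightarrow> real \<Rightarrow> bool" where
  "changepoint_condition R Q f a \<longleftrightarrow>
     (\<exists>\<delta>\<in>{0<..<1}. \<exists>q.
        (\<forall>x. is_quantile (mixture a R Q) \<delta> x \<longleftrightarrow> x = q) \<and>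
        isCont (cdf R) q \<and>
        (\<integral>\<^sup>+z. f z \<partial>Q) < \<infinity> \<and>
        score_ratio R Q (\<lambda>z. enn2real (f z)) a \<delta> q \<noteq> 1) \<and>
     (\<forall>\<delta>'\<in>{0<..<1}. \<exists>!x. is_quantile (mixture a R Q) \<delta>' x)"

definition unif01 :: "real measure" where
  "unif01 = uniform_measure lborel {0<..<1}"

definition ecdf :: "nat set \<Rightarrow> (nat \<Rightarrow> real) \<Rightarrow> real \<Rightarrow> real" where
  "ecdf I p z = (\<Sum>r\<in>I. of_bool (p r \<le> z)) / real (card I)"

definition KS :: "(real \<Rightarrow> real) \<Rightarrow> real" where
  "KS G = (SUP z. \<bar>G z - cdf unif01 z\<bar>)"

definition KS_null_cdf :: "nat \<Rightarrow> real \<Rightarrow> real" where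
  "KS_null_cdf m = cdf (distr (\<Pi>\<^sub>M i\<in>{1..m}. unif01) borel (\<lambda>u. sqrt (real m) * KS (ecdf {1..m} u)))"

text \<open>Throughout, \<open>x j\<close> is the \<open>j\<close>-th observation and \<open>\<theta> t r\<close> the randomiser used at position \<open>r\<close>
  when the candidate changepoint \<open>t\<close> is examined.\<close>

definition mcp_rank :: "nat \<Rightarrow> (nat \<Rightarrow> real) \<Rightarrow> (nat \<Rightarrow> nat \<Rightarrow> real) \<Rightarrow> nat \<Rightarrow> nat \<Rightarrow> real" where
  "mcp_rank n x \<theta> t r =
     (if r \<le> t
      then (\<Sum>j\<in>{1..r}. of_bool (x j > x r) + \<theta> t r * of_bool (x j = x r)) / real r
      else (\<Sum>j\<in>{r..n}. of_bool (x j > x r) + \<theta> t r * of_bool (x j = x r)) / real (n - r + 1))"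

definition W_left :: "nat \<Rightarrow> (nat \<Rightarrow> real) \<Rightarrow> (nat \<Rightarrow> nat \<Rightarrow> real) \<Rightarrow> nat \<Rightarrow> real" where
  "W_left n x \<theta> t = sqrt (real t) * KS (ecdf {1..t} (mcp_rank n x \<theta> t))"

definition W_right :: "nat \<Rightarrow> (nat \<Rightarrow> real) \<Rightarrow> (nat \<Rightarrow> nat \<Rightarrow> real) \<Rightarrow> nat \<Rightarrow> real" where
  "W_right n x \<theta> t = sqrt (real (n - t)) * KS (ecdf {t+1..n} (mcp_rank n x \<theta> t))"

definition p_left :: "nat \<Rightarrow> (nat \<Rightarrow> real) \<Rightarrow> (nat \<Rightarrow> nat \<Rightarrow> real) \<Rightarrow> nat \<Rightarrow> real" where
  "p_left n x \<theta> t = 1 - KS_null_cdf t (W_left n x \<theta> t)"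

definition p_right :: "nat \<Rightarrow> (nat \<Rightarrow> real) \<Rightarrow> (nat \<Rightarrow> nat \<Rightarrow> real) \<Rightarrow> nat \<Rightarrow> real" where
  "p_right n x \<theta> t = 1 - KS_null_cdf (n - t) (W_right n x \<theta> t)"

definition p_CONF :: "nat \<Rightarrow> (nat \<Rightarrow> real) \<Rightarrow> (nat \<Rightarrow> nat \<Rightarrow> real) \<Rightarrow> nat \<Rightarrow> real" where
  "p_CONF n x \<theta> t = Min {2 * p_left n x \<theta> t, 2 * p_right n x \<theta> t, 1}"

definition C_MCP :: "nat \<Rightarrow> real \<Rightarrow> (nat \<Rightarrow> real) \<Rightarrow> (nat \<Rightarrow> nat \<Rightarrow> real) \<Rightarrow> nat set" where
  "C_MCP n \<alpha> x \<theta> = {t\<in>{1..n-1}. p_CONF n x \<theta> t > \<alpha>}"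

definition mcp_test :: "nat \<Rightarrow> real \<Rightarrow> nat \<Rightarrow> (nat \<Rightarrow> real) \<Rightarrow> (nat \<Rightarrow> nat \<Rightarrow> real) \<Rightarrow> real" where
  "mcp_test n \<alpha> t x \<theta> = of_bool (t \<notin> C_MCP n \<alpha> x \<theta>)"

lemma mcp_test_eq:
  "t \<in> {1..n-1} \<Longrightarrow> mcp_test n \<alpha> t x \<theta> = of_bool (p_CONF n x \<theta> t \<le> \<alpha>)"
  by (auto simp: mcp_test_def C_MCP_def)

text \<open>Index \<open>Inl j\<close> stands for the observation \<open>X j\<close>, index \<open>Inr (t, r)\<close> for the randomiser
  \<open>\<theta> t r\<close>. Mutual independence of the combined family expresses at once that each block of the
  data is independent, that the two blocks are independent of one another, and that
  the randomisers are independent of one another and of the data.\<close>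

definition changepoint_row ::
    "'a measure \<Rightarrow> real measure \<Rightarrow> real measure \<Rightarrow> nat \<Rightarrow> nat \<Rightarrow>
     (nat \<Rightarrow> 'a \<Rightarrow> real) \<Rightarrow> (nat \<Rightarrow> nat \<Rightarrow> 'a \<Rightarrow> real) \<Rightarrow> bool" where
  "changepoint_row M R Q n \<tau> X \<theta> \<longleftrightarrow>
     prob_space M \<and>
     prob_space.indep_vars M (\<lambda>_. borel) (case_sum X (\<lambda>(t, r). \<theta> t r))
       ({1..n} <+> {1..n-1} \<times> {1..n}) \<and>
     (\<forall>j\<in>{1..n}. distr M borel (X j) = (if j \<le> \<tau> then R else Q)) \<and>
     (\<forall>t\<in>{1..n-1}. \<forall>r\<in>{1..n}. distr M borel (\<theta> t r) = unif01)"

definition cp_index :: "real \<Rightarrow> nat \<Rightarrow> nat" where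
  "cp_index c n = nat \<lfloor>c * real n\<rfloor>"

definition large_enough :: "real \<Rightarrow> real \<Rightarrow> nat \<Rightarrow> bool" where
  "large_enough c c' n \<longleftrightarrow>
     cp_index c n \<in> {1..n-1} \<and> cp_index c' n \<in> {1..n-1} \<and> cp_index c n \<noteq> cp_index c' n"

end

theory Submission
  imports Defs
begin

text \<open>
  \<^bold>\<open>Level.\<close> Transposing position \<open>i\<close> with position \<open>r \<ge> i\<close> of an i.i.d. sample leaves its law and all ranks
  after position \<open>r\<close> unchanged. Averaging over \<open>i\<close> shows that the randomised sequential ranks are i.i.d.
  uniform. At the true change point both blocks are i.i.d. (the right one read backwards), so the two
  Kolmogorov--Smirnov statistics have exactly the tabulated null law. This law has no atoms, hence each of
  the two \<open>p\<close>-values is uniform, and a union bound gives the level.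

  \<^bold>\<open>Consistency.\<close> At a wrong candidate, one of the two blocks, read in the right direction, consists of
  \<open>k\<close> observations from some \<open>P0\<close> followed by observations from \<open>P1 \<noteq> P0\<close>. By Glivenko--Cantelli the rank at
  position \<open>r > k\<close> is close to \<open>1 - H (X r)\<close>, where \<open>H = l P0 + (1 - l) P1\<close> and \<open>l = k / r\<close>. If \<open>H w = \<zeta>\<close>
  then \<open>P1 w - \<zeta> = l (P1 w - P0 w)\<close>. For suitable \<open>\<zeta>\<close> this difference is bounded away from 0 with a sign that
  does not depend on \<open>l\<close>, so the contributions of different \<open>r\<close> cannot cancel, and the empirical distribution
  function of the ranks stays away from the uniform one at \<open>1 - \<zeta>\<close>. The score condition
  guarantees \<open>R \<noteq> Q\<close>, since for \<open>R = Q\<close> the score ratio is 1.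
\<close>

text \<open>The rows live on unrelated probability spaces \<open>M n\<close>, so consistency rests
  on explicit error probabilities rather than on almost sure limits; their constants depend only on
  the two distributions, the level and a lower bound for l (1 - l), where l = k / m is the fraction
  of the block before the change. The first obstacle is that a rank at a small position r compares
  with few observations, so a union bound over all positions fails. What stays bounded, by a
  geometric series, is the expected number of positions with a bad empirical distribution function;
  Markov's inequality then gives a failure probability of order 1 / m. The second obstacle is that
  the weight k / r falls with r, so the quantile at level \<open>\<zeta>\<close> moves. Taking
  \<open>\<zeta>\<close> in the middle of a gap between P0 x0 and P1 x0 keeps the sign of P1 - P0 at
  all these quantiles. If the true change t' precedes the candidate t, the left block is used, with
  k = t' and m = t. Otherwise it is the right block read backwards, with k = n - t', m = n - t and R
  and Q exchanged.\<close>

subsection \<open>The Kolmogorov--Smirnov statistic and its null law\<close>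

lemma prob_space_unif01: "prob_space unif01"
  unfolding unif01_def by (rule prob_space_uniform_measure) auto

lemma sets_unif01 [simp, measurable_cong]: "sets unif01 = sets borel"
  by (simp add: unif01_def)

lemma space_unif01 [simp]: "space unif01 = UNIV"
  by (simp add: unif01_def)

lemma emeasure_unif01: "A \<in> sets borel \<Longrightarrow> emeasure unif01 A = emeasure lborel ({0<..<1} \<inter> A)"
  by (simp add: unif01_def divide_ennreal_def)

lemma cdf_unif01: "cdf unif01 z = max 0 (min 1 z)"
proof -
  have "{0<..<1} \<inter> {..z} = (if z < 1 then {0<..z} else {0<..<1})" by auto
  then have "emeasure unif01 {..z} = ennreal (max 0 (min 1 z))"
    by (subst emeasure_unif01) (auto simp: max_def min_def)
  then show ?thesis unfolding cdf_def measure_def by (simp only:) (auto simp: max_def)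
qed

lemma isCont_cdf_unif01: "isCont (cdf unif01) z"
  unfolding cdf_unif01[abs_def] by (intro continuous_intros)

lemma AE_unif01: "AE u in unif01. u \<in> {0<..<1}"
  unfolding unif01_def by (rule AE_uniform_measureI) auto

section \<open>The Kolmogorov-Smirnov distance of a finite sample\<close>

lemma ecdf_nonneg: "0 \<le> ecdf I p z"
  by (simp add: ecdf_def sum_nonneg)

lemma ecdf_le_1: "ecdf I p z \<le> 1"
proof -
  have "(\<Sum>r\<in>I. of_bool (p r \<le> z)) \<le> (\<Sum>r\<in>I. (1::real))" by (intro sum_mono) auto
  then show ?thesis by (cases "card I = 0") (simp_all add: ecdf_def divide_simps)
qed

lemma KS_deviation_le_1: "\<bar>ecdf I p z - cdf unif01 z\<bar> \<le> 1"
  using ecdf_nonneg[of I p z] ecdf_le_1[of I p z] by (auto simp: cdf_unif01)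

lemma KS_ge: "\<bar>ecdf I p z - cdf unif01 z\<bar> \<le> KS (ecdf I p)"
  unfolding KS_def by (rule cSUP_upper) (auto intro!: bdd_aboveI2[where M=1] KS_deviation_le_1)

lemma KS_le: "(\<And>z. \<bar>ecdf I p z - cdf unif01 z\<bar> \<le> w) \<Longrightarrow> KS (ecdf I p) \<le> w"
  unfolding KS_def by (rule cSUP_least) auto

lemma ecdf_cong: "(\<And>r. r \<in> I \<Longrightarrow> p r = p' r) \<Longrightarrow> ecdf I p = ecdf I p'"
  by (simp add: ecdf_def fun_eq_iff)

lemma ecdf_right_eventually_const:
  assumes "finite I"
  shows "eventually (\<lambda>y. ecdf I p y = ecdf I p z) (at_right z)"
proof -
  have "\<forall>r\<in>I. eventually (\<lambda>y. (p r \<le> y) = (p r \<le> z)) (at_right z)"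
  proof
    fix r show "eventually (\<lambda>y. (p r \<le> y) = (p r \<le> z)) (at_right z)"
    proof (cases "p r \<le> z")
      case True
      then show ?thesis by (auto intro: eventually_mono[OF eventually_at_right_less])
    next
      case False
      then show ?thesis
        by (auto simp: eventually_at_right_field intro!: exI[of _ "p r"])
    qed
  qed
  then have "eventually (\<lambda>y. \<forall>r\<in>I. (p r \<le> y) = (p r \<le> z)) (at_right z)"
    using assms by (simp add: eventually_ball_finite)
  then show ?thesis by eventually_elim (simp add: ecdf_def)
qed

text \<open>Measurability of the statistic needs a countable supremum. A deviation above w at z
  persists just to the right of z, where the step function is constant and the uniform one
  continuous, and so it occurs at a rational point.\<close>

lemma KS_le_iff_rat:
  assumes "finite I"
  shows "KS (ecdf I p) \<le> w \<longleftrightarrow> (\<forall>z\<in>\<rat>. \<bar>ecdf I p z - cdf unif01 z\<bar> \<le> w)"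
proof
  assume *: "\<forall>z\<in>\<rat>. \<bar>ecdf I p z - cdf unif01 z\<bar> \<le> w"
  show "KS (ecdf I p) \<le> w"
  proof (rule KS_le, rule ccontr)
    fix z assume "\<not> \<bar>ecdf I p z - cdf unif01 z\<bar> \<le> w"
    moreover have "((\<lambda>y. \<bar>ecdf I p z - cdf unif01 y\<bar>) \<longlongrightarrow> \<bar>ecdf I p z - cdf unif01 z\<bar>) (at_right z)"
      using isCont_cdf_unif01[of z]
      by (intro tendsto_intros) (simp add: isCont_def filterlim_at_split)
    ultimately have "eventually (\<lambda>y. \<bar>ecdf I p z - cdf unif01 y\<bar> > w) (at_right z)"
      by (auto simp: order_tendsto_iff)
    with ecdf_right_eventually_const[OF assms, of p z]
    have "eventually (\<lambda>y. \<bar>ecdf I p y - cdf unif01 y\<bar> > w) (at_right z)"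
      by eventually_elim simp
    then obtain b where "z < b" and b: "\<And>y. z < y \<Longrightarrow> y < b \<Longrightarrow> \<bar>ecdf I p y - cdf unif01 y\<bar> > w"
      by (auto simp: eventually_at_right_field)
    then obtain y where "y \<in> \<rat>" "z < y" "y < b" using Rats_dense_in_real by blast
    then show False using b * by force
  qed
qed (meson KS_ge order_trans)

lemma borel_measurable_ecdf [measurable (raw)]:
  assumes "\<And>r. r \<in> I \<Longrightarrow> (\<lambda>\<omega>. P \<omega> r) \<in> borel_measurable M"
  shows "(\<lambda>\<omega>. ecdf I (P \<omega>) z) \<in> borel_measurable M"
  unfolding ecdf_def using assms by measurable

lemma borel_measurable_KS:
  assumes "finite I" and "\<And>r. r \<in> I \<Longrightarrow> (\<lambda>\<omega>. P \<omega> r) \<in> borel_measurable M"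
  shows "(\<lambda>\<omega>. KS (ecdf I (P \<omega>))) \<in> borel_measurable M"
proof (rule borel_measurableI_le)
  fix w
  have [measurable]: "(\<lambda>\<omega>. ecdf I (P \<omega>) z) \<in> borel_measurable M" for z
    using assms(2) by (rule borel_measurable_ecdf)
  have "{\<omega>\<in>space M. KS (ecdf I (P \<omega>)) \<le> w}
      = {\<omega>\<in>space M. \<forall>z\<in>\<rat>. \<bar>ecdf I (P \<omega>) z - cdf unif01 z\<bar> \<le> w}"
    by (simp add: KS_le_iff_rat[OF assms(1)])
  also have "\<dots> \<in> sets M"
    by (intro sets.sets_Collect_countable_All' countable_rat) measurable
  finally show "{\<omega>\<in>space M. KS (ecdf I (P \<omega>)) \<le> w} \<in> sets M" .
qed

text \<open>Between consecutive sample points the empirical function is constant while the uniform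
  one increases, so the supremum is a deviation at a sample point or a left limit at one. The
  distance is thus tied to a single coordinate by one of finitely many affine relations, which is
  what rules out atoms.\<close>

lemma KS_attained:
  assumes fin: "finite I" and ne: "I \<noteq> {}" and p: "\<And>r. r \<in> I \<Longrightarrow> p r \<in> {0<..<1}"
  shows "\<exists>r\<in>I. \<exists>k\<le>card I. KS (ecdf I p) = real k / real (card I) - p r
                        \<or> KS (ecdf I p) = p r - real k / real (card I)"
proof -
  define m where "m = card I"
  have m: "m > 0" using fin ne by (simp add: m_def card_gt_0_iff)
  \<comment> \<open>Divided by m, \<open>F\<close> gives the value of the empirical function and
    \<open>F'\<close> its left limit.\<close>
  define F where "F z = card {r\<in>I. p r \<le> z}" for z
  define F' where "F' z = card {r\<in>I. p r < z}" for z
  have F: "ecdf I p z = real (F z) / real m" for z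
    using fin by (simp add: ecdf_def m_def F_def Int_def)
  have Fm: "F z \<le> m" "F' z \<le> m" for z
    using fin by (auto simp: F_def F'_def m_def intro!: card_mono)
  define S where "S = (\<lambda>r. real (F (p r)) / m - p r) ` I \<union> (\<lambda>r. p r - real (F' (p r)) / m) ` I"
  have S: "finite S" "S \<noteq> {}" using fin ne by (auto simp: S_def)
  have upper: "\<exists>s\<in>S. \<bar>ecdf I p z - cdf unif01 z\<bar> \<le> s" for z
  proof -
    obtain r0 where r0: "r0 \<in> I" using ne by auto
    \<comment> \<open>This covers a zero deviation: since \<open>F'\<close> is at most
      \<open>F\<close>, one of the two candidates at \<open>p r0\<close> is nonnegative.\<close>
    have nn: "\<exists>s\<in>S. 0 \<le> s"
    proof (cases "F (p r0) / m \<ge> p r0")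
      case False
      have "F' (p r0) \<le> F (p r0)" unfolding F_def F'_def using fin by (intro card_mono) auto
      then have "real (F' (p r0)) / m \<le> real (F (p r0)) / m" by (simp add: divide_right_mono)
      then have "0 \<le> p r0 - real (F' (p r0)) / m" using False by linarith
      then show ?thesis using r0 by (intro bexI[of _ "p r0 - real (F' (p r0)) / m"]) (auto simp: S_def)
    next
      case True
      then show ?thesis using r0 by (intro bexI[of _ "real (F (p r0)) / m - p r0"]) (auto simp: S_def)
    qed
    consider "ecdf I p z = cdf unif01 z" | "ecdf I p z > cdf unif01 z" | "ecdf I p z < cdf unif01 z"
      by linarith
    then show ?thesis
    proof cases
      case 1 then show ?thesis using nn by simp
    next
      case 2
      then have "F z > 0" unfolding F cdf_unif01 by (cases "F z = 0") auto
      then have "{r\<in>I. p r \<le> z} \<noteq> {}" unfolding F_def by (metis card.empty less_irrefl)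
      define A where "A = {r\<in>I. p r \<le> z}"
      have A: "finite (p ` A)" "p ` A \<noteq> {}" using fin \<open>{r\<in>I. p r \<le> z} \<noteq> {}\<close> by (auto simp: A_def)
      obtain r where r: "r \<in> A" "Max (p ` A) = p r" using Max_in[OF A] by auto
      have eq: "{j\<in>I. p j \<le> z} = {j\<in>I. p j \<le> p r}"
        using r A Max_ge[OF A(1)] unfolding A_def by force
      have "p r \<le> cdf unif01 z" "r \<in> I" using r p[of r] by (auto simp: cdf_unif01 A_def)
      moreover have "F z = F (p r)" using eq by (simp add: F_def)
      ultimately show ?thesis using 2
        by (intro bexI[of _ "real (F (p r)) / m - p r"]) (auto simp: F S_def)
    next
      case 3
      have "{r\<in>I. p r > z} \<noteq> {}"
      proof
        assume "{r\<in>I. p r > z} = {}"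
        then have "{r\<in>I. p r \<le> z} = I" by force
        then have "ecdf I p z = 1" using m by (simp add: F F_def m_def)
        then show False using 3 by (simp add: cdf_unif01 split: if_splits)
      qed
      define A where "A = {r\<in>I. p r > z}"
      have A: "finite (p ` A)" "p ` A \<noteq> {}" using fin \<open>{r\<in>I. p r > z} \<noteq> {}\<close> by (auto simp: A_def)
      obtain r where r: "r \<in> A" "Min (p ` A) = p r" using Min_in[OF A] by auto
      have eq: "{j\<in>I. p j \<le> z} = {j\<in>I. p j < p r}"
        using r A Min_le[OF A(1)] unfolding A_def by force
      have "cdf unif01 z \<le> p r" "r \<in> I" using r p[of r] by (auto simp: cdf_unif01 A_def)
      moreover have "F z = F' (p r)" using eq by (simp add: F_def F'_def)
      ultimately show ?thesis using 3
        by (intro bexI[of _ "p r - real (F' (p r)) / m"]) (auto simp: F S_def)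
    qed
  qed
  have lower: "s \<le> KS (ecdf I p)" if "s \<in> S" for s
  proof -
    consider r where "r \<in> I" "s = real (F (p r)) / m - p r" | r where "r \<in> I" "s = p r - real (F' (p r)) / m"
      using \<open>s \<in> S\<close> unfolding S_def by blast
    then show ?thesis
    proof cases
      case 1
      then show ?thesis using KS_ge[of I p "p r"] p[of r] by (auto simp: F cdf_unif01)
    next
      case 2
      show ?thesis
      proof (rule field_le_epsilon)
        fix e :: real assume e: "e > 0"
        \<comment> \<open>A left limit need not be attained. This z lies below \<open>p r\<close>
          but within e of it, is at least every smaller sample point, and lies in [0, 1), where the
          uniform function is the identity.\<close>
        define z where "z = Max (insert (max 0 (p r - e)) (p ` {j\<in>I. p j < p r}))"
        have fz: "finite (insert (max 0 (p r - e)) (p ` {j\<in>I. p j < p r}))" using fin by simp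
        have "z < p r" unfolding z_def using fz e p[OF 2(1)] by (subst Max_less_iff) auto
        moreover have "max 0 (p r - e) \<le> z" unfolding z_def using fz by (intro Max_ge) auto
        moreover have "p j \<le> z" if "j \<in> I" "p j < p r" for j
          unfolding z_def using fz that by (intro Max_ge) auto
        ultimately have z: "z < p r" "z \<ge> 0" "z \<ge> p r - e" "\<And>j. j \<in> I \<Longrightarrow> p j < p r \<Longrightarrow> p j \<le> z"
          by auto
        then have "{j\<in>I. p j \<le> z} = {j\<in>I. p j < p r}" by force
        then have "F z = F' (p r)" by (simp add: F_def F'_def)
        then show "s \<le> KS (ecdf I p) + e"
          using KS_ge[of I p z] z p[OF 2(1)] 2 by (auto simp: F cdf_unif01)
      qed
    qed
  qed
  have "KS (ecdf I p) = Max S"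
  proof (rule antisym)
    show "KS (ecdf I p) \<le> Max S"
      by (rule KS_le) (meson upper Max_ge[OF S(1)] order_trans)
    show "Max S \<le> KS (ecdf I p)" using S lower by simp
  qed
  then have "KS (ecdf I p) \<in> S" using Max_in[OF S] by simp
  then show ?thesis using Fm unfolding S_def m_def by auto
qed


section \<open>The null law and its lack of atoms\<close>

lemma sigma_finite_unif01: "sigma_finite_measure unif01"
  using prob_space_unif01 by (simp add: prob_space_imp_sigma_finite)

definition KS_null :: "nat \<Rightarrow> real measure" where
  "KS_null m = distr (\<Pi>\<^sub>M i\<in>{1..m}. unif01) borel (\<lambda>u. sqrt (real m) * KS (ecdf {1..m} u))"

lemma KS_null_cdf_eq: "KS_null_cdf m = cdf (KS_null m)"
  by (simp add: KS_null_cdf_def KS_null_def)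

lemma measurable_KS_PiM [measurable]:
  "(\<lambda>u. sqrt (real m) * KS (ecdf {1..m} u)) \<in> borel_measurable (\<Pi>\<^sub>M i\<in>{1..m}. unif01)"
  by (intro borel_measurable_times borel_measurable_const borel_measurable_KS) auto

lemma real_distribution_KS_null: "real_distribution (KS_null m)"
proof -
  interpret prob_space "\<Pi>\<^sub>M i\<in>{1..m}. unif01" by (intro prob_space_PiM prob_space_unif01)
  show ?thesis unfolding KS_null_def
    by (rule real_distribution_distr) measurable
qed

text \<open>By \<open>KS_attained\<close> the value w forces some coordinate into a finite set
  depending on w and m only, and that set is null for the uniform law. Continuity is what makes the
  p-value exactly uniform at the true change point.\<close>

lemma isCont_KS_null_cdf:
  assumes "m \<ge> 1"
  shows "isCont (KS_null_cdf m) w"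
proof -
  interpret P: prob_space "\<Pi>\<^sub>M i\<in>{1..m}. unif01" by (intro prob_space_PiM prob_space_unif01)
  interpret D: real_distribution "KS_null m" by (rule real_distribution_KS_null)
  \<comment> \<open>The solutions for a coordinate of the two relations in
    \<open>KS_attained\<close>, with the distance set to w / sqrt m.\<close>
  define B where "B = (\<lambda>k. real k / real m - w / sqrt (real m)) ` {..m} \<union> (\<lambda>k. real k / real m + w / sqrt (real m)) ` {..m}"
  have "finite B" by (simp add: B_def)
  then have "countable B" by (rule countable_finite)
  then have "B \<in> null_sets unif01"
    by (intro null_setsI) (auto simp: emeasure_unif01 emeasure_lborel_countable countable_Int2 sets.countable)
  then have "AE u in unif01. u \<in> {0<..<1} \<and> u \<notin> B"
    using AE_unif01 AE_not_in by (intro AE_conjI)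
  then have "AE u in (\<Pi>\<^sub>M i\<in>{1..m}. unif01). u r \<in> {0<..<1} \<and> u r \<notin> B" if "r \<in> {1..m}" for r
    using that prob_space_unif01 by (intro AE_PiM_component) auto
  then have "AE u in (\<Pi>\<^sub>M i\<in>{1..m}. unif01). \<forall>r\<in>{1..m}. u r \<in> {0<..<1} \<and> u r \<notin> B"
    by (intro AE_finite_allI) auto
  then have "AE u in (\<Pi>\<^sub>M i\<in>{1..m}. unif01). sqrt (real m) * KS (ecdf {1..m} u) \<noteq> w"
  proof eventually_elim
    case (elim u)
    show ?case
    proof
      assume "sqrt (real m) * KS (ecdf {1..m} u) = w"
      then have w: "KS (ecdf {1..m} u) = w / sqrt (real m)" using assms by (simp add: field_simps)
      obtain r k where "r \<in> {1..m}" "k \<le> m"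
        and "KS (ecdf {1..m} u) = real k / real m - u r \<or> KS (ecdf {1..m} u) = u r - real k / real m"
        using KS_attained[of "{1..m}" u] elim assms by auto
      then have "u r = real k / real m - w / sqrt (real m) \<or> u r = real k / real m + w / sqrt (real m)"
        unfolding w by auto
      then have "u r \<in> B" using \<open>k \<le> m\<close> by (auto simp: B_def)
      then show False using elim \<open>r \<in> {1..m}\<close> by auto
    qed
  qed
  then have "AE x in KS_null m. x \<noteq> w"
    unfolding KS_null_def by (subst AE_distr_iff[OF measurable_KS_PiM]) auto
  then have "emeasure (KS_null m) {w} = 0"
    by (subst (asm) AE_iff_measurable[where N="{w}"]) auto
  then show ?thesis unfolding KS_null_cdf_eq D.isCont_cdf by (simp add: measure_def)
qed

subsection \<open>Quantiles and a Glivenko--Cantelli bound\<close>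

text \<open>The point is the least quantile, the infimum of a closed superlevel set; left continuity
  gives the exact value v. \<open>F\<close> is a plain function because it will also be an average
  of several distribution functions.\<close>

lemma superlevel_set_of_continuous_cdf:
  fixes F :: "real \<Rightarrow> real"
  assumes mono: "\<And>x y. x \<le> y \<Longrightarrow> F x \<le> F y" and cont: "\<And>x. isCont F x"
    and bot: "(F \<longlongrightarrow> 0) at_bot" and top: "(F \<longlongrightarrow> 1) at_top" and v: "0 < v" "v < 1"
  obtains w where "F w = v" "{x. v \<le> F x} = {w..}"
proof -
  define S where "S = {x. v \<le> F x}"
  have "eventually (\<lambda>x. F x < v) at_bot" using order_tendstoD(2)[OF bot v(1)] .
  then obtain a where a: "\<And>x. x \<le> a \<Longrightarrow> F x < v" by (auto simp: eventually_at_bot_linorder)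
  have "eventually (\<lambda>x. v < F x) at_top" using order_tendstoD(1)[OF top v(2)] .
  then obtain b where b: "\<And>x. b \<le> x \<Longrightarrow> v < F x" by (auto simp: eventually_at_top_linorder)
  have ne: "S \<noteq> {}" using b[of b] by (auto simp: S_def intro: less_imp_le)
  have bb: "bdd_below S" using a by (intro bdd_belowI[of _ a]) (metis S_def linorder_not_le less_imp_le mem_Collect_eq nle_le)
  have cl: "closed S" unfolding S_def
    using cont by (intro closed_Collect_le) (auto simp: continuous_on_eq_continuous_at)
  define w where "w = Inf S"
  have wS: "w \<in> S" unfolding w_def by (rule closed_contains_Inf[OF ne bb cl])
  have eq: "S = {w..}"
  proof
    show "S \<subseteq> {w..}" using bb by (auto simp: w_def intro: cInf_lower)
    show "{w..} \<subseteq> S" using wS mono by (force simp: S_def)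
  qed
  have "F w = v"
  proof (rule antisym)
    have "(F \<longlongrightarrow> F w) (at_left w)" using cont[of w] by (simp add: isCont_def filterlim_at_split)
    moreover have "eventually (\<lambda>x. F x \<le> v) (at_left w)"
    proof (rule eventually_mono)
      show "eventually (\<lambda>x. x < w) (at_left w)" by (simp add: eventually_at_filter)
      fix x assume "x < w" then have "x \<notin> S" using eq by simp
      then show "F x \<le> v" by (simp add: S_def)
    qed
    ultimately show "F w \<le> v" by (intro tendsto_upperbound[of F "F w" "at_left w"]) auto
  qed (use wS in \<open>simp add: S_def\<close>)
  then show thesis using that eq by (auto simp: S_def)
qed

lemma (in real_distribution) measure_Ici_eq:
  assumes "isCont (cdf M) w"
  shows "measure M {w..} = 1 - cdf M w"
proof -
  have "measure M {w..} = measure M {w} + measure M {w<..}"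
    by (subst finite_measure_Union[symmetric]) (auto intro!: arg_cong[where f="measure M"])
  also have "measure M {w} = 0" using assms isCont_cdf by simp
  also have "measure M {w<..} = 1 - cdf M w"
    using prob_compl[of "{..w}"] unfolding cdf_def by (simp add: Compl_eq_Diff_UNIV[symmetric] Compl_atMost)
  finally show ?thesis by simp
qed

text \<open>The probability integral transform in upper tail form, which is the shape of the event
  that a p-value is at most 1 - v.\<close>

lemma (in real_distribution) measure_cdf_superlevel:
  assumes "\<And>x. isCont (cdf M) x" "0 < v" "v < 1"
  shows "measure M {x. v \<le> cdf M x} = 1 - v"
proof -
  obtain w where "cdf M w = v" "{x. v \<le> cdf M x} = {w..}"
    using superlevel_set_of_continuous_cdf[OF cdf_nondecreasing assms(1) cdf_lim_at_bot cdf_lim_at_top_prob assms(2,3)]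
    by blast
  then show ?thesis using measure_Ici_eq[OF assms(1)] by simp
qed

text \<open>The deterministic half of Glivenko-Cantelli: monotonicity spreads closeness at N - 1
  quantiles to all x, one grid step costing e / 2 and the deviation on the grid another e / 2. The
  strict count is bounded below and the weak one above because randomised ranks lie between the two,
  see \<open>seq_rank_bounds\<close>.\<close>

lemma grid_deviation_bound:
  fixes y :: "'i \<Rightarrow> real" and H :: "real \<Rightarrow> real"
  assumes J: "finite J" "J \<noteq> {}" and mono: "\<And>x x'. x \<le> x' \<Longrightarrow> H x \<le> H x'"
    and H01: "\<And>x. 0 \<le> H x" "\<And>x. H x \<le> 1"
    and N: "N > 0" "2 / real N \<le> e"
    and q: "\<And>i. i \<in> {1..<N} \<Longrightarrow> H (q i) = real i / real N"
    and dev: "\<And>i. i \<in> {1..<N} \<Longrightarrow> \<bar>(\<Sum>j\<in>J. of_bool (y j \<le> q i)) / real (card J) - real i / real N\<bar> \<le> e / 2"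
  shows "H x - e \<le> (\<Sum>j\<in>J. of_bool (y j < x)) / real (card J)"
    and "(\<Sum>j\<in>J. of_bool (y j \<le> x)) / real (card J) \<le> H x + e"
proof -
  have r: "real (card J) > 0" using J by (simp add: card_gt_0_iff)
  \<comment> \<open>The largest index with k / N strictly below \<open>H x\<close>, so that
    \<open>q k < x\<close> and the strict count at x can be compared. When it is 0 there is no
    quantile, but then \<open>H x\<close> is at most 1 / N.\<close>
  define k where "k = nat \<lceil>real N * H x\<rceil> - 1"
  show "H x - e \<le> (\<Sum>j\<in>J. of_bool (y j < x)) / real (card J)"
  proof (cases "real N * H x \<le> 1")
    case True
    then have "H x \<le> 1 / real N" using N by (simp add: field_simps)
    moreover have "1 / real N \<le> 2 / real N" by (simp add: divide_right_mono)
    ultimately have "H x \<le> e" using N(2) by linarith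
    moreover have "0 \<le> (\<Sum>j\<in>J. of_bool (y j < x)) / real (card J)" by (simp add: sum_nonneg)
    ultimately show ?thesis by linarith
  next
    case False
    then have "\<lceil>real N * H x\<rceil> \<ge> 2" by linarith
    then have "int k = \<lceil>real N * H x\<rceil> - 1" unfolding k_def by linarith
    then have k: "real k = real_of_int \<lceil>real N * H x\<rceil> - 1" "k \<ge> 1"
      using \<open>\<lceil>real N * H x\<rceil> \<ge> 2\<close> by linarith+
    have "real N * H x \<le> real N" using H01(2)[of x] N by (simp add: mult_left_le)
    then have kN: "real k < real N * H x" "real N * H x \<le> real k + 1" unfolding k(1) by linarith+
    then have "k \<in> {1..<N}" using k(2) \<open>real N * H x \<le> real N\<close> by auto
    have "real k / real N < H x" using kN N by (simp add: field_simps)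
    then have "H (q k) < H x" using q[OF \<open>k \<in> _\<close>] by simp
    then have "q k < x" using mono by (meson linorder_not_le)
    then have "(\<Sum>j\<in>J. of_bool (y j \<le> q k)) \<le> (\<Sum>j\<in>J. of_bool (y j < x) :: real)"
      by (intro sum_mono) auto
    then have "(\<Sum>j\<in>J. of_bool (y j \<le> q k)) / real (card J) \<le> (\<Sum>j\<in>J. of_bool (y j < x)) / real (card J)"
      using r by (simp add: divide_right_mono)
    moreover have "H x \<le> real k / real N + 1 / real N" using kN N by (simp add: field_simps)
    moreover have "1 / real N \<le> e / 2" using N by simp
    ultimately show ?thesis using dev[OF \<open>k \<in> _\<close>] unfolding abs_le_iff by linarith
  qed
  \<comment> \<open>The smallest index with l / N strictly above \<open>H x\<close>. If it reaches N
    there is no quantile, and the trivial bound 1 takes its place.\<close>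
  define l where "l = nat \<lfloor>real N * H x\<rfloor> + 1"
  have l: "real l = real_of_int \<lfloor>real N * H x\<rfloor> + 1" "l \<ge> 1"
    using H01(1)[of x] by (auto simp: l_def)
  have lN: "real N * H x < real l" "real l \<le> real N * H x + 1" unfolding l(1) by linarith+
  then have l': "H x < real l / real N" "real l / real N \<le> H x + 1 / real N"
    using N by (simp_all add: field_simps)
  have N2: "1 / real N \<le> e / 2" using N by simp
  show "(\<Sum>j\<in>J. of_bool (y j \<le> x)) / real (card J) \<le> H x + e"
  proof (cases "l < N")
    case False
    have "(\<Sum>j\<in>J. of_bool (y j \<le> x)) \<le> (\<Sum>j\<in>J. 1 :: real)" by (intro sum_mono) auto
    then have "(\<Sum>j\<in>J. of_bool (y j \<le> x)) / real (card J) \<le> 1" using r by simp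
    also have "1 \<le> real l / real N" using False N by simp
    also have "\<dots> \<le> H x + e" using l'(2) N2 zero_le_divide_1_iff[of "real N"] by linarith
    finally show ?thesis .
  next
    case True
    then have "l \<in> {1..<N}" using l by simp
    have "H x < H (q l)" using q[OF \<open>l \<in> _\<close>] l' by simp
    then have "x < q l" using mono by (meson linorder_not_le)
    then have "(\<Sum>j\<in>J. of_bool (y j \<le> x)) \<le> (\<Sum>j\<in>J. of_bool (y j \<le> q l) :: real)"
      by (intro sum_mono) auto
    then have "(\<Sum>j\<in>J. of_bool (y j \<le> x)) / real (card J) \<le> (\<Sum>j\<in>J. of_bool (y j \<le> q l)) / real (card J)"
      using r by (simp add: divide_right_mono)
    with dev[OF \<open>l \<in> _\<close>] l' N2 show ?thesis unfolding abs_le_iff by linarith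
  qed
qed

text \<open>The variables need not be identically distributed and the sets may vary with j: the
  lemma serves both the quantile grid and the half-lines whose end point moves with the
  position.\<close>

lemma (in prob_space) Hoeffding_of_bool:
  assumes J: "finite J" "J \<noteq> {}" and ind: "indep_vars (\<lambda>_. borel) Y J"
    and A: "\<And>j. j \<in> J \<Longrightarrow> A j \<in> sets borel" and e: "e \<ge> 0"
  shows "{\<omega>\<in>space M. \<bar>(\<Sum>j\<in>J. of_bool (Y j \<omega> \<in> A j)) / real (card J)
           - (\<Sum>j\<in>J. measure (distr M borel (Y j)) (A j)) / real (card J)\<bar> \<ge> e} \<in> events" (is "?B \<in> _")
    and "prob {\<omega>\<in>space M. \<bar>(\<Sum>j\<in>J. of_bool (Y j \<omega> \<in> A j)) / real (card J)
           - (\<Sum>j\<in>J. measure (distr M borel (Y j)) (A j)) / real (card J)\<bar> \<ge> e}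
         \<le> 2 * exp (- 2 * e\<^sup>2 * real (card J))"
proof -
  have r: "real (card J) > 0" using J by (simp add: card_gt_0_iff)
  have Y: "random_variable borel (Y j)" if "j \<in> J" for j using ind that by (auto simp: indep_vars_def)
  have meas: "(\<lambda>\<omega>. of_bool (Y j \<omega> \<in> A j) :: real) \<in> borel_measurable M" if "j \<in> J" for j
    using Y[OF that] A[OF that] by measurable
  show "?B \<in> events" using meas by measurable
  have E: "expectation (\<lambda>\<omega>. of_bool (Y j \<omega> \<in> A j)) = measure (distr M borel (Y j)) (A j)" if "j \<in> J" for j
  proof -
    have "expectation (\<lambda>\<omega>. of_bool (Y j \<omega> \<in> A j)) = expectation (indicator (Y j -` A j \<inter> space M))"
      by (intro Bochner_Integration.integral_cong) (auto simp: indicator_def)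
    also have "\<dots> = measure (distr M borel (Y j)) (A j)"
      using Y[OF that] A[OF that] by (simp add: measure_distr)
    finally show ?thesis .
  qed
  have mu: "(\<Sum>j\<in>J. expectation (\<lambda>\<omega>. of_bool (Y j \<omega> \<in> A j))) = (\<Sum>j\<in>J. measure (distr M borel (Y j)) (A j))"
    using E by (intro sum.cong) auto
  have ind': "indep_vars (\<lambda>_. borel) (\<lambda>j \<omega>. of_bool (Y j \<omega> \<in> A j) :: real) J"
  proof (rule indep_vars_compose2[OF ind])
    fix j assume "j \<in> J"
    then have [measurable]: "A j \<in> sets borel" by (rule A)
    show "(\<lambda>y. of_bool (y \<in> A j) :: real) \<in> borel_measurable borel" by measurable
  qed
  interpret H: Hoeffding_ineq M J "\<lambda>j \<omega>. of_bool (Y j \<omega> \<in> A j)" "\<lambda>_. 0" "\<lambda>_. 1"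
      "\<Sum>j\<in>J. measure (distr M borel (Y j)) (A j)"
    by unfold_locales (use J ind' mu in auto)
  have "?B = {\<omega>\<in>space M. \<bar>(\<Sum>j\<in>J. of_bool (Y j \<omega> \<in> A j)) - (\<Sum>j\<in>J. measure (distr M borel (Y j)) (A j))\<bar> \<ge> e * real (card J)}"
    using r by (auto simp: field_simps simp flip: diff_divide_distrib)
  also have "prob \<dots> \<le> 2 * exp (-2 * (e * real (card J))\<^sup>2 / (\<Sum>j\<in>J. (1 - 0)\<^sup>2))"
    using e r by (intro H.Hoeffding_ineq_abs_ge) auto
  also have "-2 * (e * real (card J))\<^sup>2 / (\<Sum>j\<in>J. (1 - 0)\<^sup>2) = - 2 * e\<^sup>2 * real (card J)"
    using r by (simp add: power2_eq_square)
  finally show "prob ?B \<le> 2 * exp (- 2 * e\<^sup>2 * real (card J))" .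
qed

text \<open>Hoeffding at each of the N - 1 quantiles of the averaged distribution function and a
  union bound over them. The exponential rate matters, since these probabilities will be summed over
  all sample sizes up to m.\<close>

lemma (in prob_space) Glivenko_Cantelli_bound:
  fixes H :: "real \<Rightarrow> real"
  assumes J: "finite J" "J \<noteq> {}" and ind: "indep_vars (\<lambda>_. borel) Y J"
    and cont: "\<And>j x. j \<in> J \<Longrightarrow> isCont (cdf (distr M borel (Y j))) x"
    and H: "\<And>x. H x = (\<Sum>j\<in>J. cdf (distr M borel (Y j)) x) / real (card J)"
    and N: "N > 0" "2 / real N \<le> e" and e: "e > 0"
  shows "\<exists>B\<in>events. prob B \<le> 2 * real N * exp (- (e\<^sup>2 / 2) * real (card J)) \<and>
    (\<forall>\<omega>\<in>space M - B. \<forall>x. H x - e \<le> (\<Sum>j\<in>J. of_bool (Y j \<omega> < x)) / real (card J) \<and>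
       (\<Sum>j\<in>J. of_bool (Y j \<omega> \<le> x)) / real (card J) \<le> H x + e)"
proof -
  have r: "real (card J) > 0" using J by (simp add: card_gt_0_iff)
  have Y: "random_variable borel (Y j)" if "j \<in> J" for j using ind that by (auto simp: indep_vars_def)
  have D: "real_distribution (distr M borel (Y j))" if "j \<in> J" for j
    using Y[OF that] by (rule real_distribution_distr)
  have c: "0 \<le> cdf (distr M borel (Y j)) x" "cdf (distr M borel (Y j)) x \<le> 1"
    "((cdf (distr M borel (Y j))) \<longlongrightarrow> 0) at_bot" "((cdf (distr M borel (Y j))) \<longlongrightarrow> 1) at_top" 
    "x \<le> x' \<Longrightarrow> cdf (distr M borel (Y j)) x \<le> cdf (distr M borel (Y j)) x'" if "j \<in> J" for j x x'
  proof -
    interpret D: real_distribution "distr M borel (Y j)" by (rule D[OF that])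
    show "0 \<le> cdf (distr M borel (Y j)) x" "cdf (distr M borel (Y j)) x \<le> 1"
    "((cdf (distr M borel (Y j))) \<longlongrightarrow> 0) at_bot" "((cdf (distr M borel (Y j))) \<longlongrightarrow> 1) at_top" 
    "x \<le> x' \<Longrightarrow> cdf (distr M borel (Y j)) x \<le> cdf (distr M borel (Y j)) x'"
      by (fact D.cdf_nonneg D.cdf_bounded_prob D.cdf_lim_at_bot D.cdf_lim_at_top_prob D.cdf_nondecreasing)+
  qed
  have Hfun: "H = (\<lambda>x. (\<Sum>j\<in>J. cdf (distr M borel (Y j)) x) / real (card J))"
    using H by auto
  have mono: "H x \<le> H x'" if "x \<le> x'" for x x'
    unfolding H using c(5) that r by (intro divide_right_mono sum_mono) auto
  have H0: "0 \<le> H x" for x unfolding H using c(1) by (intro divide_nonneg_nonneg sum_nonneg) auto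
  have H1: "H x \<le> 1" for x
  proof -
    have "(\<Sum>j\<in>J. cdf (distr M borel (Y j)) x) \<le> (\<Sum>j\<in>J. 1)" using c(2) by (intro sum_mono) auto
    then show ?thesis unfolding H using r by simp
  qed
  have Hc: "isCont H x" for x unfolding Hfun using cont r by (intro continuous_intros) auto
  have bot: "(H \<longlongrightarrow> 0) at_bot"
  proof -
    have "(H \<longlongrightarrow> (\<Sum>j\<in>J. 0) / real (card J)) at_bot" unfolding Hfun using c(3) r by (intro tendsto_intros) auto
    then show ?thesis by simp
  qed
  have top: "(H \<longlongrightarrow> 1) at_top"
  proof -
    have "(H \<longlongrightarrow> (\<Sum>j\<in>J. 1) / real (card J)) at_top" unfolding Hfun using c(4) r by (intro tendsto_intros) auto
    then show ?thesis using r by simp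
  qed
  have "\<exists>w. H w = real i / real N" if "i \<in> {1..<N}" for i
    using superlevel_set_of_continuous_cdf[OF mono Hc bot top, of "real i / real N"] that by (auto simp: field_simps)
  then obtain q where q: "\<And>i. i \<in> {1..<N} \<Longrightarrow> H (q i) = real i / real N" by metis
  \<comment> \<open>Half of e is reserved for the grid, so Hoeffding is used at e / 2, and its
    exponent 2 (e / 2)^2 is the e^2 / 2 of the claim.\<close>
  define B where "B i = {\<omega>\<in>space M. \<bar>(\<Sum>j\<in>J. of_bool (Y j \<omega> \<in> {..q i})) / real (card J)
           - (\<Sum>j\<in>J. measure (distr M borel (Y j)) {..q i}) / real (card J)\<bar> \<ge> e / 2}" for i
  have B: "B i \<in> events" "prob (B i) \<le> 2 * exp (- 2 * (e/2)\<^sup>2 * real (card J))" for i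
    unfolding B_def by (rule Hoeffding_of_bool[OF J ind]; use e in simp)+
  define C where "C = (\<Union>i\<in>{1..<N}. B i)"
  have C: "C \<in> events" using B(1) by (auto simp: C_def)
  have "prob C \<le> (\<Sum>i\<in>{1..<N}. prob (B i))"
    unfolding C_def using B(1) by (intro measure_UNION_le) auto
  also have "\<dots> \<le> (\<Sum>i\<in>{1..<N}. 2 * exp (- 2 * (e/2)\<^sup>2 * real (card J)))" using B(2) by (intro sum_mono)
  also have "\<dots> = 2 * (real N - 1) * exp (- (e\<^sup>2 / 2) * real (card J))"
    using N by (simp add: power2_eq_square of_nat_diff)
  also have "\<dots> \<le> 2 * real N * exp (- (e\<^sup>2 / 2) * real (card J))"
    by (intro mult_right_mono) auto
  finally have pC: "prob C \<le> 2 * real N * exp (- (e\<^sup>2 / 2) * real (card J))" .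
  show ?thesis
  proof (intro bexI[OF _ C] conjI pC ballI allI)
    fix \<omega> x assume \<omega>: "\<omega> \<in> space M - C"
    have dev: "\<bar>(\<Sum>j\<in>J. of_bool (Y j \<omega> \<le> q i)) / real (card J) - real i / real N\<bar> \<le> e / 2" if "i \<in> {1..<N}" for i
    proof -
      have "\<omega> \<notin> B i" "\<omega> \<in> space M" using \<omega> that by (auto simp: C_def)
      then show ?thesis using q[OF that] by (simp add: B_def H cdf_def)
    qed
    show "H x - e \<le> (\<Sum>j\<in>J. of_bool (Y j \<omega> < x)) / real (card J)"
      and "(\<Sum>j\<in>J. of_bool (Y j \<omega> \<le> x)) / real (card J) \<le> H x + e"
      by (rule grid_deviation_bound[OF J mono H0 H1 N q dev]; simp)+
  qed
qed

subsection \<open>Sequential ranks of i.i.d. observations\<close>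

text \<open>Both branches of \<open>mcp_rank\<close> are instances: the left one directly, the right
  one on the row read backwards. Only this form is analysed.\<close>

definition seq_rank :: "(nat \<Rightarrow> real) \<Rightarrow> (nat \<Rightarrow> real) \<Rightarrow> nat \<Rightarrow> real" where
  "seq_rank y u r = (\<Sum>j\<in>{1..r}. of_bool (y j > y r) + u r * of_bool (y j = y r)) / real r"

lemma borel_measurable_seq_rank:
  assumes "\<And>j. j \<in> {1..r} \<Longrightarrow> Y j \<in> borel_measurable M" "U r \<in> borel_measurable M"
  shows "(\<lambda>\<omega>. seq_rank (\<lambda>j. Y j \<omega>) (\<lambda>j. U j \<omega>) r) \<in> borel_measurable M"
proof (cases "r = 0")
  case False
  then have [measurable]: "Y r \<in> borel_measurable M" using assms by simp
  note [measurable] = assms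
  show ?thesis unfolding seq_rank_def by measurable
qed (simp add: seq_rank_def)

lemma seq_rank_transpose_less:
  assumes "i \<in> {1..r}" "r < s"
  shows "seq_rank (\<lambda>j. y (Transposition.transpose i r j)) u s = seq_rank y u s"
proof -
  have "Transposition.transpose i r s = s" using assms by (simp add: Transposition.transpose_def)
  moreover have "bij_betw (Transposition.transpose i r) {1..s} {1..s}"
    using assms by (intro bij_betw_imageI inj_on_transpose) auto
  ultimately show ?thesis unfolding seq_rank_def
    using sum.reindex_bij_betw[of "Transposition.transpose i r" "{1..s}" "{1..s}"
        "\<lambda>j. of_bool (y j > y s) + u s * of_bool (y j = y s)"] by simp
qed

text \<open>The transposition puts the value \<open>y i\<close> at the last position while the
  randomiser stays there. Without ties, \<open>y i\<close> is equal only to itself, which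
  contributes the single \<open>u r\<close>.\<close>

lemma seq_rank_transpose_last:
  assumes i: "i \<in> {1..r}" and inj: "inj_on y {1..r}"
  shows "seq_rank (\<lambda>j. y (Transposition.transpose i r j)) u r
    = (real (card {j\<in>{1..r}. y j > y i}) + u r) / real r"
proof -
  have bij: "bij_betw (Transposition.transpose i r) {1..r} {1..r}"
    using assms by (intro bij_betw_imageI inj_on_transpose) auto
  have "seq_rank (\<lambda>j. y (Transposition.transpose i r j)) u r
      = (\<Sum>j\<in>{1..r}. of_bool (y j > y i) + u r * of_bool (y j = y i)) / real r"
    unfolding seq_rank_def transpose_apply_second
    using sum.reindex_bij_betw[OF bij, of "\<lambda>j. of_bool (y j > y i) + u r * of_bool (y j = y i)"] by simp
  also have "(\<Sum>j\<in>{1..r}. of_bool (y j > y i) + u r * of_bool (y j = y i))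
      = (\<Sum>j\<in>{1..r}. of_bool (y j > y i) + u r * of_bool (j = i))"
    using inj i by (intro sum.cong) (auto simp: inj_on_eq_iff)
  also have "\<dots> = real (card {j\<in>{1..r}. y j > y i}) + u r"
  proof -
    have "(\<Sum>j\<in>{1..r}. of_bool (y j > y i)) = real (card {j\<in>{1..r}. y j > y i})"
      by (simp add: Int_def)
    moreover have "(\<Sum>j\<in>{1..r}. of_bool (j = i)) = (1::real)" using i by (simp add: of_bool_def)
    ultimately show ?thesis unfolding sum.distrib sum_distrib_left[symmetric] by simp
  qed
  finally show ?thesis .
qed

lemma bij_betw_rank:
  fixes y :: "'i \<Rightarrow> real"
  assumes I: "finite I" and inj: "inj_on y I"
  shows "bij_betw (\<lambda>i. card {j\<in>I. y j > y i}) I {..<card I}"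
proof -
  have less: "card {k\<in>I. y k > y j} < card {k\<in>I. y k > y i}" if "i \<in> I" "j \<in> I" "y i < y j" for i j
    using that I by (intro psubset_card_mono) force+
  have inj': "inj_on (\<lambda>i. card {j\<in>I. y j > y i}) I"
  proof (rule inj_onI, rule ccontr)
    fix i j assume ij: "i \<in> I" "j \<in> I" "card {k\<in>I. y k > y i} = card {k\<in>I. y k > y j}" "i \<noteq> j"
    then have "y i \<noteq> y j" using inj by (auto simp: inj_on_def)
    then show False using less[of i j] less[of j i] ij by linarith
  qed
  moreover have "(\<lambda>i. card {j\<in>I. y j > y i}) ` I \<subseteq> {..<card I}"
    using I by (auto intro!: psubset_card_mono)
  ultimately show ?thesis
    by (intro bij_betw_imageI card_subset_eq) (auto simp: card_image)
qed

text \<open>Half-open cells fit together without gaps, which open ones do not; the added end point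
  is null.\<close>

lemma unif01_eq_half_open:
  assumes [measurable]: "A \<in> sets borel"
  shows "emeasure unif01 A = emeasure lborel ({0<..1} \<inter> A)"
  unfolding emeasure_unif01[OF assms]
proof (rule emeasure_eq_AE)
  have "AE x::real in lborel. x \<noteq> 1" by (rule AE_lborel_singleton)
  then show "AE x in lborel. (x \<in> {0<..<1} \<inter> A) = (x \<in> {0<..1} \<inter> A)"
    by eventually_elim auto
qed auto

text \<open>If K is uniform on the integers below r and independent of a uniform U, then (K + U) / r
  is uniform; the identity is this statement multiplied by r. The map u to (k + u) / r carries (0,
  1] onto the k-th of r cells tiling (0, 1].\<close>

lemma unif01_fractional_cells:
  assumes A [measurable]: "A \<in> sets borel" and r: "r > 0"
  shows "(\<Sum>k<r. emeasure unif01 {u. (real k + u) / real r \<in> A}) = of_nat r * emeasure unif01 A"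
proof -
  have 1: "emeasure unif01 {u. (real k + u) / real r \<in> A}
      = of_nat r * emeasure lborel ({real k / real r<..(real k + 1) / real r} \<inter> A)" for k
  proof -
    have [measurable]: "{u. (real k + u) / real r \<in> A} \<in> sets borel" by measurable
    have "emeasure unif01 {u. (real k + u) / real r \<in> A}
        = (\<integral>\<^sup>+u. indicator ({0<..1} \<inter> {u. (real k + u) / real r \<in> A}) u \<partial>lborel)"
      by (subst unif01_eq_half_open) auto
    also have "\<dots> = \<bar>real r\<bar> * (\<integral>\<^sup>+z. indicator ({0<..1} \<inter> {u. (real k + u) / real r \<in> A}) (- real k + real r * z) \<partial>lborel)"
      using r by (subst nn_integral_real_affine[where c="real r" and t="- real k"]) auto
    also have "(\<integral>\<^sup>+z. indicator ({0<..1} \<inter> {u. (real k + u) / real r \<in> A}) (- real k + real r * z) \<partial>lborel)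
        = (\<integral>\<^sup>+z. indicator ({real k / real r<..(real k + 1) / real r} \<inter> A) z \<partial>lborel)"
      using r by (intro nn_integral_cong) (auto simp: indicator_def field_simps)
    finally show ?thesis by (simp add: ennreal_of_nat_eq_real_of_nat)
  qed
  have 2: "(\<Sum>k<n. emeasure lborel ({real k / real r<..(real k + 1) / real r} \<inter> A))
      = emeasure lborel ({0<..real n / real r} \<inter> A)" for n
  proof (induction n)
    case (Suc n)
    have "{0<..real (Suc n) / real r} \<inter> A = ({0<..real n / real r} \<inter> A) \<union> ({real n / real r<..(real n + 1) / real r} \<inter> A)"
    proof -
      have split: "{0<..b} = {0<..a} \<union> {a<..b}" if "0 \<le> a" "a \<le> b" for a b :: real using that by auto
      have "{0<..real (Suc n) / real r} = {0<..real n / real r} \<union> {real n / real r<..real (Suc n) / real r}"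
        using r by (intro split divide_right_mono) auto
      then show ?thesis by (simp only: Int_Un_distrib2 of_nat_Suc add.commute[of 1])
    qed
    also have "emeasure lborel \<dots> = emeasure lborel ({0<..real n / real r} \<inter> A)
        + emeasure lborel ({real n / real r<..(real n + 1) / real r} \<inter> A)"
      by (intro plus_emeasure[symmetric]) auto
    finally show ?case using Suc by simp
  qed simp
  show ?thesis unfolding 1 sum_distrib_left[symmetric] 2 using r
    by (subst unif01_eq_half_open) auto
qed


text \<open>The canonical product space, with observations at \<open>Inl\<close> and randomisers at
  \<open>Inr\<close>. On it one can permute coordinates and integrate out a single one by
  Fubini.\<close>

locale iid_sequence_with_randomisers = real_distribution R for R :: "real measure" +
  fixes m :: nat
  assumes cont: "\<And>x. isCont (cdf R) x"
begin

definition idx :: "(nat + nat) set" where "idx = {1..m} <+> {1..m}"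

definition law :: "nat + nat \<Rightarrow> real measure" where "law = case_sum (\<lambda>_. R) (\<lambda>_. unif01)"

definition N :: "(nat + nat \<Rightarrow> real) measure" where "N = PiM idx law"

definition rk :: "(nat + nat \<Rightarrow> real) \<Rightarrow> nat \<Rightarrow> real" where
  "rk z r = seq_rank (\<lambda>j. z (Inl j)) (\<lambda>j. z (Inr j)) r"

lemma law_simps [simp]: "law (Inl j) = R" "law (Inr j) = unif01" by (simp_all add: law_def)

lemma sets_law [simp]: "sets (law k) = sets borel" by (cases k) simp_all

lemma space_law [simp]: "space (law k) = UNIV" by (cases k) simp_all

lemma prob_space_law: "prob_space (law k)"
  using prob_space_unif01 prob_space_axioms by (cases k) simp_all

lemma finite_idx [simp]: "finite idx" by (simp add: idx_def)

lemma idx_simps [simp]: "Inl j \<in> idx \<longleftrightarrow> j \<in> {1..m}" "Inr j \<in> idx \<longleftrightarrow> j \<in> {1..m}"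
  by (auto simp: idx_def)

sublocale L: product_sigma_finite law
  by (rule product_sigma_finite.intro) (intro prob_space_imp_sigma_finite prob_space_law)

sublocale N: prob_space N unfolding N_def by (intro prob_space_PiM prob_space_law)

lemma measurable_coordinate: "k \<in> idx \<Longrightarrow> (\<lambda>z. z k) \<in> borel_measurable N"
  using measurable_component_singleton[of k idx law]
  by (simp add: N_def cong: measurable_cong_sets)

lemma measurable_rk [measurable]: "r \<in> {1..m} \<Longrightarrow> (\<lambda>z. rk z r) \<in> borel_measurable N"
  unfolding rk_def by (intro borel_measurable_seq_rank measurable_coordinate) auto

lemma nn_integral_split_coordinate:
  assumes "k \<in> idx" "g \<in> borel_measurable N"
  shows "(\<integral>\<^sup>+z. g z \<partial>N) = (\<integral>\<^sup>+x. (\<integral>\<^sup>+y. g (x(k := y)) \<partial>law k) \<partial>PiM (idx - {k}) law)"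
proof -
  have "insert k (idx - {k}) = idx" using assms(1) by auto
  then show ?thesis
    using assms(2) L.product_nn_integral_insert[of "idx - {k}" k g] by (simp add: N_def)
qed

text \<open>With all coordinates but one fixed, a tie confines the remaining one to a single point,
  and R has no atoms.\<close>

lemma AE_distinct: "AE z in N. inj_on (\<lambda>j. z (Inl j)) {1..m}"
proof -
  have "AE z in N. i \<noteq> j \<longrightarrow> z (Inl i) \<noteq> z (Inl j)" if ij: "i \<in> {1..m}" "j \<in> {1..m}" for i j
  proof (cases "i = j")
    case False
    have [measurable]: "(\<lambda>z. z (Inl i)) \<in> borel_measurable N" "(\<lambda>z. z (Inl j)) \<in> borel_measurable N"
      using ij by (auto intro: measurable_coordinate)
    have S: "{z\<in>space N. z (Inl i) = z (Inl j)} \<in> sets N" by measurable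
    have "emeasure N {z\<in>space N. z (Inl i) = z (Inl j)}
        = (\<integral>\<^sup>+z. indicator {z\<in>space N. z (Inl i) = z (Inl j)} z \<partial>N)" using S by simp
    also have "\<dots> = (\<integral>\<^sup>+x. (\<integral>\<^sup>+y. indicator {z\<in>space N. z (Inl i) = z (Inl j)} (x(Inl i := y)) \<partial>R) \<partial>PiM (idx - {Inl i}) law)"
      using ij S by (subst nn_integral_split_coordinate[of "Inl i"]) auto
    also have "\<dots> \<le> (\<integral>\<^sup>+x. (\<integral>\<^sup>+y. indicator {x (Inl j)} y \<partial>R) \<partial>PiM (idx - {Inl i}) law)"
      using False by (intro nn_integral_mono) (auto simp: indicator_def)
    also have "\<dots> = (\<integral>\<^sup>+x. 0 \<partial>PiM (idx - {Inl i}) law)"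
      using cont isCont_cdf by (intro nn_integral_cong) (simp add: emeasure_eq_measure)
    finally have "emeasure N {z\<in>space N. z (Inl i) = z (Inl j)} = 0" by simp
    then show ?thesis using S by (auto intro!: AE_I[where N="{z\<in>space N. z (Inl i) = z (Inl j)}"])
  qed simp
  then have "AE z in N. \<forall>i\<in>{1..m}. \<forall>j\<in>{1..m}. i \<noteq> j \<longrightarrow> z (Inl i) \<noteq> z (Inl j)"
    by (intro AE_finite_allI) auto
  then show ?thesis by eventually_elim (auto simp: inj_on_def)
qed

text \<open>Only observations move, as the randomisers belong to positions. The restriction to
  \<open>idx\<close> keeps the result in the space of the product measure.\<close>

definition swap :: "nat \<Rightarrow> nat \<Rightarrow> (nat + nat \<Rightarrow> real) \<Rightarrow> nat + nat \<Rightarrow> real" where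
  "swap i r z = (\<lambda>k\<in>idx. z (map_sum (Transposition.transpose i r) id k))"

lemma swap_in_idx:
  "i \<in> {1..m} \<Longrightarrow> r \<in> {1..m} \<Longrightarrow> map_sum (Transposition.transpose i r) id \<in> idx \<rightarrow> idx"
  by (auto simp: idx_def Transposition.transpose_def split: if_splits)

lemma distr_swap:
  assumes "i \<in> {1..m}" "r \<in> {1..m}"
  shows "distr N N (swap i r) = N"
proof -
  have "law (map_sum (Transposition.transpose i r) id k) = law k" for k by (cases k) simp_all
  then show ?thesis
    using distr_PiM_reindex[of idx law "map_sum (Transposition.transpose i r) id" idx]
      prob_space_law swap_in_idx[OF assms]
    by (simp add: N_def swap_def[abs_def] sum.inj_map inj_on_subset[of _ UNIV])
qed

lemma measurable_swap [measurable]: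
  assumes "i \<in> {1..m}" "r \<in> {1..m}"
  shows "swap i r \<in> measurable N N"
proof -
  have "(\<lambda>z. \<lambda>k\<in>idx. z (map_sum (Transposition.transpose i r) id k)) \<in> measurable N (PiM idx law)"
  proof (rule measurable_restrict)
    fix k assume "k \<in> idx"
    then have "map_sum (Transposition.transpose i r) id k \<in> idx" using swap_in_idx[OF assms] by auto
    from measurable_coordinate[OF this]
    show "(\<lambda>z. z (map_sum (Transposition.transpose i r) id k)) \<in> measurable N (law k)"
      by (simp cong: measurable_cong_sets)
  qed
  then show ?thesis by (simp add: swap_def[abs_def] N_def)
qed

lemma rk_swap:
  assumes "i \<in> {1..r}" "s \<in> {r..m}"
  shows "rk (swap i r z) s = seq_rank (\<lambda>j. z (Inl (Transposition.transpose i r j))) (\<lambda>j. z (Inr j)) s"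
proof -
  have "Transposition.transpose i r j \<in> {1..s}" if "j \<in> {1..s}" for j
    using that assms by (auto simp: Transposition.transpose_def)
  then show ?thesis using assms
    by (auto simp: rk_def seq_rank_def swap_def intro!: sum.cong arg_cong2[where f="(/)"])
qed

text \<open>Transposing positions \<open>i \<le> r\<close> and \<open>r\<close> of the data changes neither the law nor any later rank, so
  one may average over \<open>i\<close>; the rank of position \<open>i\<close> among the first \<open>r\<close> then runs through all
  values, and the randomiser smears these out to the uniform distribution.\<close>

lemma rk_step:
  assumes r: "r \<in> {1..m}" and A [measurable]: "A \<in> sets borel"
    and B: "\<And>s. s \<in> {r<..m} \<Longrightarrow> B s \<in> sets borel"
  shows "emeasure N {z\<in>space N. rk z r \<in> A \<and> (\<forall>s\<in>{r<..m}. rk z s \<in> B s)}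
    = emeasure unif01 A * emeasure N {z\<in>space N. \<forall>s\<in>{r<..m}. rk z s \<in> B s}"
proof -
  define E where "E = {z\<in>space N. \<forall>s\<in>{r<..m}. rk z s \<in> B s}"
  have E [measurable]: "E \<in> sets N"
    unfolding E_def
  proof (rule sets.sets_Collect_finite_All)
    fix s assume s: "s \<in> {r<..m}"
    have [measurable]: "B s \<in> sets borel" "(\<lambda>z. rk z s) \<in> borel_measurable N" using B[OF s] s r by auto
    show "{z\<in>space N. rk z s \<in> B s} \<in> sets N" by measurable
  qed simp
  have [measurable]: "(\<lambda>z. rk z r) \<in> borel_measurable N" using r by simp
  define S where "S = {z\<in>space N. rk z r \<in> A \<and> z \<in> E}"
  have S [measurable]: "S \<in> sets N" unfolding S_def by measurable
  \<comment> \<open>The ranks after r do not read the randomiser of position r, so the 0 put there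
    is an arbitrary value.\<close>
  define e where "e x = (indicator E (x(Inr r := 0)) :: ennreal)" for x
  have E_upd: "indicator E (x(Inr r := y)) = e x" if "x \<in> space (PiM (idx - {Inr r}) law)" for x y
  proof -
    have "rk (x(Inr r := y)) s = rk (x(Inr r := 0)) s" if "s \<in> {r<..m}" for s
      using that by (simp add: rk_def seq_rank_def)
    moreover have "x(Inr r := y) \<in> space N" for y
      using that r by (auto simp: N_def space_PiM PiE_def extensional_def)
    ultimately show ?thesis unfolding e_def E_def by (simp add: indicator_def)
  qed
  have rm [measurable]: "(\<lambda>z. z (Inr r)) \<in> borel_measurable N" using r by (intro measurable_coordinate) simp
  \<comment> \<open>By invariance of the law, each of the r transposed copies of \<open>S\<close>
    has the measure of \<open>S\<close>.\<close>
  have "of_nat r * emeasure N S = (\<Sum>i\<in>{1..r}. emeasure N (swap i r -` S \<inter> space N))"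
  proof -
    have "emeasure N (swap i r -` S \<inter> space N) = emeasure N S" if "i \<in> {1..r}" for i
      using emeasure_distr[of "swap i r" N N S] distr_swap[of i r] measurable_swap[of i r] that r by auto
    then show ?thesis by simp
  qed
  also have "\<dots> = (\<Sum>i\<in>{1..r}. \<integral>\<^sup>+z. indicator (swap i r -` S \<inter> space N) z \<partial>N)"
  proof (intro sum.cong refl)
    fix i assume "i \<in> {1..r}"
    then have "swap i r -` S \<inter> space N \<in> sets N" using r measurable_swap[of i r] by auto
    then show "emeasure N (swap i r -` S \<inter> space N) = (\<integral>\<^sup>+z. indicator (swap i r -` S \<inter> space N) z \<partial>N)" by simp
  qed
  also have "\<dots> = (\<integral>\<^sup>+z. (\<Sum>i\<in>{1..r}. indicator (swap i r -` S \<inter> space N) z) \<partial>N)"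
  proof (rule nn_integral_sum[symmetric])
    fix i assume "i \<in> {1..r}"
    then have [measurable]: "swap i r -` S \<inter> space N \<in> sets N" using r measurable_swap[of i r] by auto
    show "indicator (swap i r -` S \<inter> space N) \<in> borel_measurable N" by measurable
  qed
  \<comment> \<open>Almost surely there are no ties, so the sum over the transposed position i
    becomes a sum over the possible ranks k. The event \<open>E\<close> is unaffected by the
    transpositions and factors out.\<close>
  also have "\<dots> = (\<integral>\<^sup>+z. (\<Sum>k<r. indicator A ((real k + z (Inr r)) / real r)) * indicator E z \<partial>N)"
  proof (rule nn_integral_cong_AE)
    show "AE z in N. (\<Sum>i\<in>{1..r}. indicator (swap i r -` S \<inter> space N) z)
      = (\<Sum>k<r. indicator A ((real k + z (Inr r)) / real r)) * (indicator E z :: ennreal)"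
      using AE_distinct AE_space
    proof eventually_elim
      case (elim z)
      let ?c = "\<lambda>i. card {j\<in>{1..r}. z (Inl j) > z (Inl i)}"
      have inj: "inj_on (\<lambda>j. z (Inl j)) {1..r}" using elim(1) r by (auto intro: inj_on_subset)
      have *: "indicator (swap i r -` S \<inter> space N) z
          = indicator A ((real (?c i) + z (Inr r)) / real r) * (indicator E z :: ennreal)" if i: "i \<in> {1..r}" for i
      proof -
        have "rk (swap i r z) s = rk z s" if "s \<in> {r<..m}" for s
          using that i rk_swap[of i r s z]
            seq_rank_transpose_less[of i r s "\<lambda>j. z (Inl j)" "\<lambda>j. z (Inr j)"] by (simp add: rk_def)
        moreover have "rk (swap i r z) r = (real (?c i) + z (Inr r)) / real r"
          using i r rk_swap[of i r r z] seq_rank_transpose_last[OF i inj, of "\<lambda>j. z (Inr j)"] by simp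
        moreover have "swap i r z \<in> space N"
          using measurable_space[OF measurable_swap[of i r] elim(2)] i r by auto
        ultimately show ?thesis using elim(2) by (auto simp: indicator_def S_def E_def)
      qed
      have "(\<Sum>i\<in>{1..r}. indicator (swap i r -` S \<inter> space N) z)
          = (\<Sum>i\<in>{1..r}. indicator A ((real (?c i) + z (Inr r)) / real r) * (indicator E z :: ennreal))"
        using * by (intro sum.cong) auto
      also have "\<dots> = (\<Sum>k<r. indicator A ((real k + z (Inr r)) / real r) * indicator E z)"
        using sum.reindex_bij_betw[OF bij_betw_rank[OF _ inj], of "\<lambda>k. indicator A ((real k + z (Inr r)) / real r) * (indicator E z :: ennreal)"]
        by simp
      finally show ?case by (simp add: sum_distrib_right)
    qed
  qed
  also have "\<dots> = (\<integral>\<^sup>+x. (\<integral>\<^sup>+y. (\<Sum>k<r. indicator A ((real k + y) / real r)) * indicator E (x(Inr r := y)) \<partial>unif01) \<partial>PiM (idx - {Inr r}) law)"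
    using r by (subst nn_integral_split_coordinate[of "Inr r"]) auto
  \<comment> \<open>With the other coordinates fixed, \<open>E\<close> is constant in the
    randomiser, which is integrated over the r cells.\<close>
  also have "\<dots> = (\<integral>\<^sup>+x. (\<integral>\<^sup>+y. (of_nat r * emeasure unif01 A) * indicator E (x(Inr r := y)) \<partial>unif01) \<partial>PiM (idx - {Inr r}) law)"
  proof (rule nn_integral_cong)
    fix x assume x: "x \<in> space (PiM (idx - {Inr r}) law)"
    have "(\<lambda>y. \<Sum>k<r. indicator A ((real k + y) / real r) :: ennreal) \<in> borel_measurable borel"
      by measurable
    then have cell_sum: "(\<lambda>y. \<Sum>k<r. indicator A ((real k + y) / real r) :: ennreal) \<in> borel_measurable unif01"
      by (simp cong: measurable_cong_sets)
    have "{u. (real k + u) / real r \<in> A} \<in> sets borel" for k by measurable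
    then have cells: "{u. (real k + u) / real r \<in> A} \<in> sets unif01" for k by simp
    have "(\<integral>\<^sup>+y. (\<Sum>k<r. indicator A ((real k + y) / real r)) \<partial>unif01)
        = (\<integral>\<^sup>+y. (\<Sum>k<r. indicator {u. (real k + u) / real r \<in> A} y) \<partial>unif01)"
      by (simp add: indicator_def)
    also have "\<dots> = (\<Sum>k<r. \<integral>\<^sup>+y. indicator {u. (real k + u) / real r \<in> A} y \<partial>unif01)"
      by (intro nn_integral_sum borel_measurable_indicator cells)
    also have "\<dots> = (\<Sum>k<r. emeasure unif01 {u. (real k + u) / real r \<in> A})"
      by (intro sum.cong refl nn_integral_indicator cells)
    also have "\<dots> = of_nat r * emeasure unif01 A" using r by (intro unif01_fractional_cells) auto
    finally show "(\<integral>\<^sup>+y. (\<Sum>k<r. indicator A ((real k + y) / real r)) * indicator E (x(Inr r := y)) \<partial>unif01)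
        = (\<integral>\<^sup>+y. (of_nat r * emeasure unif01 A) * indicator E (x(Inr r := y)) \<partial>unif01)"
      using prob_space.emeasure_space_1[OF prob_space_unif01] cell_sum
      by (simp add: E_upd[OF x] nn_integral_multc)
  qed
  also have "\<dots> = (\<integral>\<^sup>+z. (of_nat r * emeasure unif01 A) * indicator E z \<partial>N)"
    using r by (subst nn_integral_split_coordinate[of "Inr r"]) auto
  also have "\<dots> = of_nat r * (emeasure unif01 A * emeasure N E)"
    by (simp add: nn_integral_cmult mult.assoc)
  finally have "emeasure N S = emeasure unif01 A * emeasure N E"
    using r by (simp add: ennreal_mult_cancel_left)
  moreover have "S = {z\<in>space N. rk z r \<in> A \<and> (\<forall>s\<in>{r<..m}. rk z s \<in> B s)}" by (auto simp: S_def E_def)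
  ultimately show ?thesis by (simp add: E_def)
qed

text \<open>Boxes determine the product measure. The induction runs downwards from m because a
  transposition with position r preserves the later ranks but not the earlier ones.\<close>

lemma distr_rk: "distr N (PiM {1..m} (\<lambda>_. unif01)) (\<lambda>z. \<lambda>r\<in>{1..m}. rk z r) = PiM {1..m} (\<lambda>_. unif01)"
proof -
  interpret U: product_sigma_finite "\<lambda>_::nat. unif01"
    by (rule product_sigma_finite.intro) (rule sigma_finite_unif01)
  show ?thesis
  proof (rule U.PiM_eqI)
    fix A :: "nat \<Rightarrow> real set" assume "\<And>i. i \<in> {1..m} \<Longrightarrow> A i \<in> sets unif01"
    then have A: "\<And>i. i \<in> {1..m} \<Longrightarrow> A i \<in> sets borel" by simp
    have ind: "emeasure N {z\<in>space N. \<forall>s\<in>{r<..m}. rk z s \<in> A s} = (\<Prod>s\<in>{r<..m}. emeasure unif01 (A s))"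
      if "r \<le> m" for r
      using that
    proof (induction rule: inc_induct)
      case base
      then show ?case by (simp add: N.emeasure_space_1)
    next
      case (step r)
      have eq: "{r<..m} = insert (Suc r) {Suc r<..m}" using step by auto
      have "{z\<in>space N. \<forall>s\<in>{r<..m}. rk z s \<in> A s} = {z\<in>space N. rk z (Suc r) \<in> A (Suc r) \<and> (\<forall>s\<in>{Suc r<..m}. rk z s \<in> A s)}"
        unfolding eq by auto
      also have "emeasure N \<dots> = emeasure unif01 (A (Suc r)) * emeasure N {z\<in>space N. \<forall>s\<in>{Suc r<..m}. rk z s \<in> A s}"
        using step A by (intro rk_step) auto
      finally show ?case unfolding step.IH eq by simp
    qed
    have meas: "(\<lambda>z. \<lambda>r\<in>{1..m}. rk z r) \<in> measurable N (PiM {1..m} (\<lambda>_. unif01))"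
      by (intro measurable_restrict) (simp cong: measurable_cong_sets)
    have "(\<lambda>z. \<lambda>r\<in>{1..m}. rk z r) -` Pi\<^sub>E {1..m} A \<inter> space N = {z\<in>space N. \<forall>s\<in>{0<..m}. rk z s \<in> A s}"
      by (auto simp: PiE_def Pi_def)
    then show "emeasure (distr N (PiM {1..m} (\<lambda>_. unif01)) (\<lambda>z. \<lambda>r\<in>{1..m}. rk z r)) (Pi\<^sub>E {1..m} A)
       = (\<Prod>i\<in>{1..m}. emeasure unif01 (A i))"
      using A meas ind[of 0] by (subst emeasure_distr) (auto intro!: sets_PiM_I_finite simp: atLeastSucAtMost_greaterThanAtMost)
  qed auto
qed

end

section \<open>From the product model to random variables on an arbitrary space\<close>

lemma (in prob_space) indep_vars_reindex:
  assumes f: "inj_on f I" and ind: "indep_vars M' X (f ` I)"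
  shows "indep_vars (\<lambda>i. M' (f i)) (\<lambda>i. X (f i)) I"
proof -
  have rv: "\<forall>i\<in>I. random_variable (M' (f i)) (X (f i))" using ind by (auto simp: indep_vars_def2)
  have "indep_sets (\<lambda>i. {X (f i) -` A \<inter> space M |A. A \<in> sets (M' (f i))}) I"
  proof (rule indep_setsI)
    fix i assume "i \<in> I"
    then show "{X (f i) -` A \<inter> space M |A. A \<in> sets (M' (f i))} \<subseteq> events"
      using rv by (auto intro: measurable_sets)
  next
    fix A J assume J: "J \<noteq> {}" "J \<subseteq> I" "finite J"
      and A: "\<forall>j\<in>J. A j \<in> {X (f j) -` A \<inter> space M |A. A \<in> sets (M' (f j))}"
    have inj: "inj_on f J" using f J inj_on_subset by blast
    have inv: "inv_into J f (f j) = j" if "j \<in> J" for j using inj that by simp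
    have "prob (\<Inter>k\<in>f ` J. A (inv_into J f k)) = (\<Prod>k\<in>f ` J. prob (A (inv_into J f k)))"
      using ind J A inv unfolding indep_vars_def2
      by (intro indep_setsD[where F="\<lambda>k. {X k -` A \<inter> space M |A. A \<in> sets (M' k)}" and I="f ` I"]) auto
    also have "\<dots> = (\<Prod>j\<in>J. prob (A j))" by (simp add: prod.reindex[OF inj] inv)
    also have "(\<Inter>k\<in>f ` J. A (inv_into J f k)) = (\<Inter>j\<in>J. A j)" by (simp add: inv)
    finally show "prob (\<Inter>j\<in>J. A j) = (\<Prod>j\<in>J. prob (A j))" .
  qed
  with rv show ?thesis by (simp add: indep_vars_def2)
qed

text \<open>One block of a row with the randomisers of one candidate. The laws of the
  \<open>Y j\<close> are left open, so that the locale serves both hypotheses.\<close>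

locale randomised_data = prob_space M for M :: "'a measure" +
  fixes Y U :: "nat \<Rightarrow> 'a \<Rightarrow> real" and m :: nat
  assumes indep: "indep_vars (\<lambda>_. borel) (case_sum Y U) ({1..m} <+> {1..m})"
    and distr_U: "\<And>j. j \<in> {1..m} \<Longrightarrow> distr M borel (U j) = unif01"
begin

definition rank_stat :: "'a \<Rightarrow> real" where
  "rank_stat \<omega> = sqrt (real m) * KS (ecdf {1..m} (seq_rank (\<lambda>j. Y j \<omega>) (\<lambda>j. U j \<omega>)))"

definition rank_pvalue :: "'a \<Rightarrow> real" where
  "rank_pvalue \<omega> = 1 - KS_null_cdf m (rank_stat \<omega>)"

lemma measurable_Y [measurable]: "j \<in> {1..m} \<Longrightarrow> random_variable borel (Y j)"
  using indep by (force simp: indep_vars_def)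

lemma measurable_U [measurable]: "j \<in> {1..m} \<Longrightarrow> random_variable borel (U j)"
  using indep by (force simp: indep_vars_def)

lemma measurable_rank [measurable]:
  "r \<in> {1..m} \<Longrightarrow> random_variable borel (\<lambda>\<omega>. seq_rank (\<lambda>j. Y j \<omega>) (\<lambda>j. U j \<omega>) r)"
  by (intro borel_measurable_seq_rank measurable_Y measurable_U) auto

lemma measurable_rank_stat [measurable]: "random_variable borel rank_stat"
  unfolding rank_stat_def by (intro borel_measurable_times borel_measurable_const borel_measurable_KS measurable_rank) auto

lemma borel_measurable_KS_null_cdf [measurable]: "KS_null_cdf l \<in> borel_measurable borel"
proof -
  interpret D: real_distribution "KS_null l" by (rule real_distribution_KS_null)
  show ?thesis unfolding KS_null_cdf_eq
    by (rule borel_measurable_mono) (simp add: mono_def D.cdf_nondecreasing)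
qed

lemma measurable_rank_pvalue [measurable]: "random_variable borel rank_pvalue"
  unfolding rank_pvalue_def by measurable

lemma indep_Y: "indep_vars (\<lambda>_. borel) Y {1..m}"
proof -
  have "indep_vars (\<lambda>_. borel) (case_sum Y U) (Inl ` {1..m})"
    by (rule indep_vars_subset[OF indep]) auto
  from indep_vars_reindex[OF _ this] show ?thesis by simp
qed

text \<open>Independence identifies the joint law of data and randomisers with the canonical product
  \<open>S.N\<close>, which \<open>distr_rk\<close> carries to m independent uniforms; these define
  the null law.\<close>

lemma distr_rank_stat:
  assumes R: "real_distribution R" "\<And>x. isCont (cdf R) x"
    and Y: "\<And>j. j \<in> {1..m} \<Longrightarrow> distr M borel (Y j) = R" and m: "m \<ge> 1"
  shows "distr M borel rank_stat = KS_null m"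
proof -
  interpret S: iid_sequence_with_randomisers R m
    using R by (simp add: iid_sequence_with_randomisers_def iid_sequence_with_randomisers_axioms_def)
  define Z where "Z \<omega> = (\<lambda>k\<in>S.idx. case_sum Y U k \<omega>)" for \<omega>
  define rv where "rv z = (\<lambda>r\<in>{1..m}. S.rk z r)" for z
  define g where "g u = sqrt (real m) * KS (ecdf {1..m} u)" for u
  have rvs: "random_variable borel (case_sum Y U k)" if "k \<in> S.idx" for k
    using that by (cases k) (auto simp: S.idx_def)
  have ne: "S.idx \<noteq> {}" using m by (auto simp: S.idx_def)
  have sets_N: "sets S.N = sets (PiM S.idx (\<lambda>_. borel))"
    unfolding S.N_def by (intro sets_PiM_cong) auto
  have "indep_vars (\<lambda>_. borel) (case_sum Y U) S.idx" using indep by (simp add: S.idx_def)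
  then have "distr M (PiM S.idx (\<lambda>_. borel)) Z = PiM S.idx (\<lambda>k. distr M borel (case_sum Y U k))"
    unfolding Z_def by (subst (asm) indep_vars_iff_distr_eq_PiM'[OF ne rvs]) auto
  also have "\<dots> = S.N" unfolding S.N_def
    by (intro PiM_cong refl) (auto simp: S.idx_def Y distr_U)
  finally have Z: "distr M S.N Z = S.N" by (simp add: sets_N cong: distr_cong)
  have mZ: "Z \<in> measurable M S.N"
    unfolding Z_def measurable_cong_sets[OF refl sets_N] by (intro measurable_restrict rvs)
  have mrv: "rv \<in> measurable S.N (PiM {1..m} (\<lambda>_. unif01))"
    unfolding rv_def by (intro measurable_restrict) (simp cong: measurable_cong_sets)
  have mg: "g \<in> borel_measurable (PiM {1..m} (\<lambda>_. unif01))"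
    unfolding g_def by (rule measurable_KS_PiM)
  have "KS_null m = distr (PiM {1..m} (\<lambda>_. unif01)) borel g" unfolding KS_null_def g_def ..
  also have "\<dots> = distr (distr (distr M S.N Z) (PiM {1..m} (\<lambda>_. unif01)) rv) borel g"
    unfolding Z rv_def S.distr_rk ..
  also have "\<dots> = distr M borel (g \<circ> (rv \<circ> Z))"
    using mZ mrv mg by (simp add: distr_distr measurable_comp)
  also have "\<dots> = distr M borel rank_stat"
  proof (rule distr_cong)
    fix \<omega>
    have "rv (Z \<omega>) r = seq_rank (\<lambda>j. Y j \<omega>) (\<lambda>j. U j \<omega>) r" if "r \<in> {1..m}" for r
      using that by (simp add: rv_def S.rk_def seq_rank_def Z_def)
    then show "(g \<circ> (rv \<circ> Z)) \<omega> = rank_stat \<omega>"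
      unfolding g_def rank_stat_def comp_def by (intro arg_cong[where f="\<lambda>F. _ * KS F"] ecdf_cong) auto
  qed auto
  finally show ?thesis by simp
qed

lemma prob_rank_pvalue_le:
  assumes R: "real_distribution R" "\<And>x. isCont (cdf R) x"
    and Y: "\<And>j. j \<in> {1..m} \<Longrightarrow> distr M borel (Y j) = R" and m: "m \<ge> 1" and u: "0 < u" "u < 1"
  shows "prob {\<omega>\<in>space M. rank_pvalue \<omega> \<le> u} = u"
proof -
  interpret D: real_distribution "KS_null m" by (rule real_distribution_KS_null)
  have "{\<omega>\<in>space M. rank_pvalue \<omega> \<le> u} = rank_stat -` {w. 1 - u \<le> cdf (KS_null m) w} \<inter> space M"
    by (auto simp: rank_pvalue_def KS_null_cdf_eq)
  also have "prob \<dots> = measure (distr M borel rank_stat) {w. 1 - u \<le> cdf (KS_null m) w}"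
  proof (rule measure_distr[symmetric])
    have "{w \<in> space borel. 1 - u \<le> KS_null_cdf m w} \<in> sets borel" by measurable
    then show "{w. 1 - u \<le> cdf (KS_null m) w} \<in> sets borel" by (simp add: KS_null_cdf_eq)
  qed measurable
  also have "distr M borel rank_stat = KS_null m" by (rule distr_rank_stat[OF R Y m])
  also have "measure (KS_null m) {w. 1 - u \<le> cdf (KS_null m) w} = 1 - (1 - u)"
    using u isCont_KS_null_cdf[OF m] by (intro D.measure_cdf_superlevel) (auto simp: KS_null_cdf_eq)
  finally show ?thesis by simp
qed

end

text \<open>The statistic of a uniform sample is o(sqrt m) in probability, by Glivenko-Cantelli for
  the coordinates of the product measure. Hence a distance bounded away from 0 drives the p-value to
  0.\<close>

lemma KS_null_cdf_tendsto_1: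
  assumes e: "e > 0"
  shows "(\<lambda>m. KS_null_cdf m (sqrt (real m) * e)) \<longlonglongrightarrow> 1"
proof -
  obtain N :: nat where N: "N > 0" "2 / real N \<le> e"
  proof -
    obtain N :: nat where "2 / e < real N" using reals_Archimedean2 by blast
    then show thesis using e that[of N] by (cases "N = 0") (auto simp: field_simps)
  qed
  define h where "h m = 1 - 2 * real N * exp (- (e\<^sup>2 / 2) * real m)" for m :: nat
  have bound: "h m \<le> KS_null_cdf m (sqrt (real m) * e)" if m: "m \<ge> 1" for m
  proof -
    interpret P: prob_space "\<Pi>\<^sub>M i\<in>{1..m}. unif01" by (intro prob_space_PiM prob_space_unif01)
    interpret D: real_distribution "KS_null m" by (rule real_distribution_KS_null)
    have rv: "P.random_variable borel (\<lambda>u. u j)" if "j \<in> {1..m}" for j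
      using measurable_component_singleton[OF that, of "\<lambda>_. unif01"] by (simp cong: measurable_cong_sets)
    have dist: "distr (\<Pi>\<^sub>M i\<in>{1..m}. unif01) borel (\<lambda>u. u j) = unif01" if "j \<in> {1..m}" for j
    proof -
      have "distr (\<Pi>\<^sub>M i\<in>{1..m}. unif01) borel (\<lambda>u. u j) = distr (\<Pi>\<^sub>M i\<in>{1..m}. unif01) unif01 (\<lambda>u. u j)"
        by (rule distr_cong) auto
      also have "\<dots> = unif01"
        using distr_PiM_component[of "{1..m}" "\<lambda>_. unif01" j] that prob_space_unif01 by simp
      finally show ?thesis .
    qed
    have ind: "P.indep_vars (\<lambda>_. borel) (\<lambda>j u. u j) {1..m}"
    proof (subst P.indep_vars_iff_distr_eq_PiM')
      have "distr (\<Pi>\<^sub>M i\<in>{1..m}. unif01) (\<Pi>\<^sub>M i\<in>{1..m}. borel) (\<lambda>x. \<lambda>i\<in>{1..m}. x i)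
          = distr (\<Pi>\<^sub>M i\<in>{1..m}. unif01) (\<Pi>\<^sub>M i\<in>{1..m}. unif01) (\<lambda>x. x)"
        by (rule distr_cong) (auto simp: space_PiM PiE_def extensional_restrict intro!: sets_PiM_cong)
      also have "\<dots> = (\<Pi>\<^sub>M i\<in>{1..m}. distr (\<Pi>\<^sub>M i\<in>{1..m}. unif01) borel (\<lambda>u. u i))"
        unfolding distr_id by (intro PiM_cong refl) (rule dist[symmetric])
      finally show "distr (\<Pi>\<^sub>M i\<in>{1..m}. unif01) (\<Pi>\<^sub>M i\<in>{1..m}. borel) (\<lambda>x. \<lambda>i\<in>{1..m}. x i)
          = (\<Pi>\<^sub>M i\<in>{1..m}. distr (\<Pi>\<^sub>M i\<in>{1..m}. unif01) borel (\<lambda>u. u i))" .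
    next
      show "{1..m} \<noteq> {}" using m by simp
    next
      fix i assume "i \<in> {1..m}" then show "P.random_variable borel (\<lambda>u. u i)" by (rule rv)
    qed
    obtain B where B: "B \<in> P.events" "P.prob B \<le> 2 * real N * exp (- (e\<^sup>2 / 2) * real m)"
      and good: "\<And>u x. u \<in> space (\<Pi>\<^sub>M i\<in>{1..m}. unif01) - B \<Longrightarrow>
        cdf unif01 x - e \<le> (\<Sum>j\<in>{1..m}. of_bool (u j < x)) / real m \<and>
        (\<Sum>j\<in>{1..m}. of_bool (u j \<le> x)) / real m \<le> cdf unif01 x + e"
    proof -
      have cm: "card {1..m} = m" by simp
      have cdf_j: "cdf (distr (\<Pi>\<^sub>M i\<in>{1..m}. unif01) borel (\<lambda>u. u j)) = cdf unif01" if "j \<in> {1..m}" for j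
        unfolding dist[OF that] ..
      have "(\<Sum>j\<in>{1..m}. cdf (distr (\<Pi>\<^sub>M i\<in>{1..m}. unif01) borel (\<lambda>u. u j)) x) = (\<Sum>j\<in>{1..m}. cdf unif01 x)" for x
        by (intro sum.cong refl) (simp only: cdf_j)
      then have avg: "cdf unif01 x = (\<Sum>j\<in>{1..m}. cdf (distr (\<Pi>\<^sub>M i\<in>{1..m}. unif01) borel (\<lambda>u. u j)) x) / real (card {1..m})" for x
        using m by (simp only:) simp
      have c: "isCont (cdf (distr (\<Pi>\<^sub>M i\<in>{1..m}. unif01) borel (\<lambda>u. u j))) x" if "j \<in> {1..m}" for j x
        unfolding cdf_j[OF that] by (rule isCont_cdf_unif01)
      have ne: "{1..m} \<noteq> {}" using m by simp
      show thesis
        using P.Glivenko_Cantelli_bound[OF finite_atLeastAtMost ne ind c avg N e] that unfolding cm by metis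
    qed
    have "h m \<le> 1 - P.prob B" using B by (simp add: h_def)
    also have "\<dots> = P.prob (space (\<Pi>\<^sub>M i\<in>{1..m}. unif01) - B)" by (rule P.prob_compl[symmetric, OF B(1)])
    also have "\<dots> \<le> P.prob {u\<in>space (\<Pi>\<^sub>M i\<in>{1..m}. unif01). sqrt (real m) * KS (ecdf {1..m} u) \<le> sqrt (real m) * e}"
    proof (rule P.finite_measure_mono)
      show "space (\<Pi>\<^sub>M i\<in>{1..m}. unif01) - B
        \<subseteq> {u\<in>space (\<Pi>\<^sub>M i\<in>{1..m}. unif01). sqrt (real m) * KS (ecdf {1..m} u) \<le> sqrt (real m) * e}"
      proof
        fix u assume u: "u \<in> space (\<Pi>\<^sub>M i\<in>{1..m}. unif01) - B"
        have "KS (ecdf {1..m} u) \<le> e"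
        proof (rule KS_le)
          fix x
          have "(\<Sum>j\<in>{1..m}. of_bool (u j < x)) / real m \<le> (\<Sum>j\<in>{1..m}. of_bool (u j \<le> x)) / real m"
            by (intro divide_right_mono sum_mono) auto
          with good[OF u, of x] show "\<bar>ecdf {1..m} u x - cdf unif01 x\<bar> \<le> e"
            unfolding ecdf_def abs_le_iff by simp
        qed
        then show "u \<in> {u\<in>space (\<Pi>\<^sub>M i\<in>{1..m}. unif01). sqrt (real m) * KS (ecdf {1..m} u) \<le> sqrt (real m) * e}"
          using u by (auto intro!: mult_left_mono)
      qed
      show "{u\<in>space (\<Pi>\<^sub>M i\<in>{1..m}. unif01). sqrt (real m) * KS (ecdf {1..m} u) \<le> sqrt (real m) * e} \<in> P.events"
        using measurable_KS_PiM by (intro borel_measurable_le borel_measurable_const)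
    qed
    also have "\<dots> = KS_null_cdf m (sqrt (real m) * e)"
    proof -
      let ?g = "\<lambda>u. sqrt (real m) * KS (ecdf {1..m} u)"
      have "KS_null_cdf m (sqrt (real m) * e) = P.prob (?g -` {..sqrt (real m) * e} \<inter> space (\<Pi>\<^sub>M i\<in>{1..m}. unif01))"
        unfolding KS_null_cdf_eq cdf_def KS_null_def by (rule measure_distr[OF measurable_KS_PiM]) simp
      also have "?g -` {..sqrt (real m) * e} \<inter> space (\<Pi>\<^sub>M i\<in>{1..m}. unif01)
          = {u\<in>space (\<Pi>\<^sub>M i\<in>{1..m}. unif01). ?g u \<le> sqrt (real m) * e}" by blast
      finally show ?thesis by (rule sym)
    qed
    finally show ?thesis .
  qed
  have "h \<longlonglongrightarrow> 1 - 2 * real N * 0"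
  proof -
    have "(\<lambda>m. exp (- (e\<^sup>2 / 2)) ^ m) \<longlonglongrightarrow> 0" using e by (intro LIMSEQ_realpow_zero) auto
    then have "(\<lambda>m. exp (- (e\<^sup>2 / 2) * real m)) \<longlonglongrightarrow> 0"
      by (simp add: exp_of_nat_mult[symmetric] mult.commute)
    then show ?thesis unfolding h_def by (intro tendsto_intros)
  qed
  then have h: "h \<longlonglongrightarrow> 1" by simp
  have "KS_null_cdf m x \<le> 1" for m x
  proof -
    interpret D: real_distribution "KS_null m" by (rule real_distribution_KS_null)
    show ?thesis unfolding KS_null_cdf_eq by (rule D.cdf_bounded_prob)
  qed
  then show ?thesis
    by (intro tendsto_sandwich[OF _ _ h tendsto_const])
       (auto simp: eventually_sequentially intro!: exI[of _ 1] bound)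
qed

subsection \<open>Ranks after a change point\<close>

text \<open>Were \<open>G x \<le> F x\<close> at such a point \<open>x\<close>, the two functions would agree somewhere between \<open>x0\<close> and \<open>x\<close>,
  and the common value, being also that of the convex combination, would lie on the wrong side of the
  interval \<open>(F x0, G x0)\<close>.\<close>

lemma convex_combination_separation:
  fixes F G :: "real \<Rightarrow> real"
  assumes F: "real_distribution P" "F = cdf P" "\<And>x. isCont F x"
    and G: "real_distribution P'" "G = cdf P'" "\<And>x. isCont G x"
    and less: "F x0 < G x0"
  obtains \<zeta> \<epsilon> \<gamma> where "\<epsilon> > 0" "\<gamma> > 0" "0 < \<zeta> - \<epsilon>" "\<zeta> + \<epsilon> < 1"
    "\<And>l x. 0 \<le> l \<Longrightarrow> l \<le> 1 \<Longrightarrow> \<bar>l * F x + (1 - l) * G x - \<zeta>\<bar> \<le> \<epsilon> \<Longrightarrow> \<gamma> \<le> G x - F x"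
proof -
  interpret P: real_distribution P by fact
  interpret P': real_distribution P' by fact
  have mono: "F x \<le> F y" "G x \<le> G y" if "x \<le> y" for x y
    using that F(2) G(2) P.cdf_nondecreasing P'.cdf_nondecreasing by auto
  have F0: "0 \<le> F x0" and G1: "G x0 \<le> 1"
    using F(2) G(2) P.cdf_nonneg P'.cdf_bounded_prob by auto
  \<comment> \<open>The midpoint and a quarter of the width of the gap, so that the closed band of
    radius \<open>\<epsilon>\<close> about \<open>\<zeta>\<close> lies strictly inside (F x0, G
    x0).\<close>
  define \<zeta> where "\<zeta> = (F x0 + G x0) / 2"
  define \<epsilon> where "\<epsilon> = (G x0 - F x0) / 4"
  have e: "\<epsilon> > 0" "F x0 < \<zeta> - \<epsilon>" "\<zeta> + \<epsilon> < G x0"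
    using less by (simp_all add: \<epsilon>_def \<zeta>_def field_simps)
  have z01: "0 < \<zeta> - \<epsilon>" "\<zeta> + \<epsilon> < 1" using e F0 G1 by linarith+
  \<comment> \<open>Weight and point form one argument, because the bound \<open>\<gamma>\<close>
    has to be uniform in both and is found by compactness of a set of pairs.\<close>
  define H where "H p = fst p * F (snd p) + (1 - fst p) * G (snd p)" for p :: "real \<times> real"
  have combo: "F x \<le> c \<Longrightarrow> G x \<le> c \<Longrightarrow> H (l, x) \<le> c" "c \<le> F x \<Longrightarrow> c \<le> G x \<Longrightarrow> c \<le> H (l, x)"
    if "0 \<le> l" "l \<le> 1" for l x c
    using that convex_bound_le[of "F x" c "G x" l "1 - l"] convex_bound_le[of "- F x" "- c" "- G x" l "1 - l"]
    by (auto simp: H_def)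
  have Hmono: "H (l, x) \<le> H (l, y)" if "0 \<le> l" "l \<le> 1" "x \<le> y" for l x y
    using that mono by (auto simp: H_def intro!: add_mono mult_left_mono)
  have pos: "F x < G x" if l: "0 \<le> l" "l \<le> 1" and near: "\<bar>H (l, x) - \<zeta>\<bar> \<le> \<epsilon>" for l x
  proof (rule ccontr)
    assume "\<not> F x < G x"
    then have le: "G x - F x \<le> 0" by simp
    have cont: "isCont (\<lambda>x. G x - F x) y" for y using F(3) G(3) by (intro continuous_intros) auto
    have "x \<noteq> x0" using le less by auto
    then consider "x0 < x" | "x < x0" by linarith
    then show False
    proof cases
      case 1
      obtain y where y: "x0 \<le> y" "y \<le> x" "G y - F y = 0"
        using IVT2[of "\<lambda>x. G x - F x" x 0 x0] le less cont 1 by auto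
      have "G x0 \<le> H (l, y)" using mono(2)[OF y(1)] y(3) l by (intro combo) auto
      also have "\<dots> \<le> H (l, x)" using y l by (intro Hmono)
      finally show False using near e by linarith
    next
      case 2
      obtain y where y: "x \<le> y" "y \<le> x0" "G y - F y = 0"
        using IVT[of "\<lambda>x. G x - F x" x 0 x0] le less cont 2 by auto
      have "H (l, x) \<le> H (l, y)" using y l by (intro Hmono)
      also have "\<dots> \<le> F x0" using mono(1)[OF y(2)] y(3) l by (intro combo) auto
      finally show False using near e by linarith
    qed
  qed
  \<comment> \<open>Far out both functions are on the same side of the band, and so is every convex
    combination. This confines x to a bounded interval whatever the weight.\<close>
  have "eventually (\<lambda>x. F x < \<zeta> - \<epsilon> \<and> G x < \<zeta> - \<epsilon>) at_bot"
    unfolding F(2) G(2) using z01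
    by (intro eventually_conj order_tendstoD(2)[OF P.cdf_lim_at_bot] order_tendstoD(2)[OF P'.cdf_lim_at_bot])
  then obtain A where A: "\<And>x. x \<le> A \<Longrightarrow> F x < \<zeta> - \<epsilon> \<and> G x < \<zeta> - \<epsilon>"
    by (auto simp: eventually_at_bot_linorder)
  have "eventually (\<lambda>x. \<zeta> + \<epsilon> < F x \<and> \<zeta> + \<epsilon> < G x) at_top"
    unfolding F(2) G(2) using z01
    by (intro eventually_conj order_tendstoD(1)[OF P.cdf_lim_at_top_prob] order_tendstoD(1)[OF P'.cdf_lim_at_top_prob])
  then obtain B where B: "\<And>x. B \<le> x \<Longrightarrow> \<zeta> + \<epsilon> < F x \<and> \<zeta> + \<epsilon> < G x"
    by (auto simp: eventually_at_top_linorder)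
  define K where "K = ({0..1} \<times> {A..B}) \<inter> {p. \<bar>H p - \<zeta>\<bar> \<le> \<epsilon>}"
  have K: "(l, x) \<in> K" if l: "0 \<le> l" "l \<le> 1" and near: "\<bar>H (l, x) - \<zeta>\<bar> \<le> \<epsilon>" for l x
  proof -
    have "A \<le> x"
    proof (rule ccontr)
      assume "\<not> A \<le> x"
      then have "F x < \<zeta> - \<epsilon>" "G x < \<zeta> - \<epsilon>" using A[of x] by auto
      then have "H (l, x) < \<zeta> - \<epsilon>" using l convex_bound_lt[of "F x" "\<zeta> - \<epsilon>" "G x" l "1 - l"] by (simp add: H_def)
      then show False using near by linarith
    qed
    moreover have "x \<le> B"
    proof (rule ccontr)
      assume "\<not> x \<le> B"
      then have "\<zeta> + \<epsilon> < F x" "\<zeta> + \<epsilon> < G x" using B[of x] by auto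
      then have "H (l, x) > \<zeta> + \<epsilon>"
        using l convex_bound_lt[of "- F x" "- (\<zeta> + \<epsilon>)" "- G x" l "1 - l"] by (simp add: H_def)
      then show False using near by linarith
    qed
    ultimately show ?thesis using l near by (simp add: K_def)
  qed
  have cF: "continuous_on UNIV F" and cG: "continuous_on UNIV G"
    using F(3) G(3) by (auto simp: continuous_on_eq_continuous_at)
  have c: "continuous_on UNIV (\<lambda>p::real \<times> real. F (snd p))" "continuous_on UNIV (\<lambda>p::real \<times> real. G (snd p))"
    by (auto intro!: continuous_on_compose2[OF cF] continuous_on_compose2[OF cG] continuous_intros)
  have "closed {p. \<bar>H p - \<zeta>\<bar> \<le> \<epsilon>}"
    unfolding H_def by (intro closed_Collect_le continuous_intros c)
  then have cpt: "compact K" unfolding K_def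
    by (intro compact_Int_closed compact_Times compact_Icc)
  \<comment> \<open>A positive continuous function attains a positive minimum on a nonempty compact
    set; for empty \<open>K\<close> the value 1 serves.\<close>
  obtain \<gamma> where \<gamma>: "\<gamma> > 0" "\<And>p. p \<in> K \<Longrightarrow> \<gamma> \<le> G (snd p) - F (snd p)"
  proof (cases "K = {}")
    case False
    have "continuous_on K (\<lambda>p. G (snd p) - F (snd p))"
      by (intro continuous_intros continuous_on_subset[OF c(1)] continuous_on_subset[OF c(2)]) auto
    then obtain p0 where p0: "p0 \<in> K" "\<And>p. p \<in> K \<Longrightarrow> G (snd p0) - F (snd p0) \<le> G (snd p) - F (snd p)"
      using continuous_attains_inf[OF cpt False] by blast
    have "G (snd p0) - F (snd p0) > 0" using p0(1) pos[of "fst p0" "snd p0"] by (auto simp: K_def)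
    then show thesis using that p0(2) by blast
  qed (use that[of 1] in auto)
  show thesis
    by (rule that[OF e(1) \<gamma>(1) z01]) (use K \<gamma>(2) in \<open>fastforce simp: H_def\<close>)
qed

text \<open>Which function is the larger one near the chosen level is recorded in s, so that later
  arguments treat both orders at once. Exchanging the roles of \<open>P0\<close> and
  \<open>P1\<close> replaces the weight l by 1 - l.\<close>

lemma distinct_cdf_separation:
  assumes P0: "real_distribution P0" "\<And>x. isCont (cdf P0) x"
    and P1: "real_distribution P1" "\<And>x. isCont (cdf P1) x" and ne: "P0 \<noteq> P1"
  obtains s \<zeta> \<epsilon> \<gamma> :: real where "s = 1 \<or> s = - 1" "\<epsilon> > 0" "\<gamma> > 0" "0 < \<zeta> - \<epsilon>" "\<zeta> + \<epsilon> < 1"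
    "\<And>l x. 0 \<le> l \<Longrightarrow> l \<le> 1 \<Longrightarrow> \<bar>l * cdf P0 x + (1 - l) * cdf P1 x - \<zeta>\<bar> \<le> \<epsilon> \<Longrightarrow>
      \<gamma> \<le> s * (cdf P1 x - cdf P0 x)"
proof -
  have "cdf P0 \<noteq> cdf P1" using cdf_unique[OF P0(1) P1(1)] ne by blast
  then obtain x0 where "cdf P0 x0 \<noteq> cdf P1 x0" by auto
  then consider "cdf P0 x0 < cdf P1 x0" | "cdf P1 x0 < cdf P0 x0" by linarith
  then show thesis
  proof cases
    case 1
    show thesis
    proof (rule convex_combination_separation[OF P0(1) refl P0(2) P1(1) refl P1(2) 1])
      fix \<zeta> \<epsilon> \<gamma> :: real
      assume pos: "\<epsilon> > 0" "\<gamma> > 0" "0 < \<zeta> - \<epsilon>" "\<zeta> + \<epsilon> < 1"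
        and sep: "\<And>l x. 0 \<le> l \<Longrightarrow> l \<le> 1 \<Longrightarrow> \<bar>l * cdf P0 x + (1 - l) * cdf P1 x - \<zeta>\<bar> \<le> \<epsilon>
          \<Longrightarrow> \<gamma> \<le> cdf P1 x - cdf P0 x"
      show thesis
      proof (rule that[of "1" \<epsilon> \<gamma> \<zeta>])
        fix l x :: real
        assume "0 \<le> l" "l \<le> 1" "\<bar>l * cdf P0 x + (1 - l) * cdf P1 x - \<zeta>\<bar> \<le> \<epsilon>"
        then show "\<gamma> \<le> 1 * (cdf P1 x - cdf P0 x)"
          using sep[of l x] by (simp add: add.commute)
      qed (use pos in auto)
    qed
  next
    case 2
    show thesis
    proof (rule convex_combination_separation[OF P1(1) refl P1(2) P0(1) refl P0(2) 2])
      fix \<zeta> \<epsilon> \<gamma> :: real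
      assume pos: "\<epsilon> > 0" "\<gamma> > 0" "0 < \<zeta> - \<epsilon>" "\<zeta> + \<epsilon> < 1"
        and sep: "\<And>l x. 0 \<le> l \<Longrightarrow> l \<le> 1 \<Longrightarrow> \<bar>l * cdf P1 x + (1 - l) * cdf P0 x - \<zeta>\<bar> \<le> \<epsilon>
          \<Longrightarrow> \<gamma> \<le> cdf P0 x - cdf P1 x"
      show thesis
      proof (rule that[of "- 1" \<epsilon> \<gamma> \<zeta>])
        fix l x :: real
        assume "0 \<le> l" "l \<le> 1" "\<bar>l * cdf P0 x + (1 - l) * cdf P1 x - \<zeta>\<bar> \<le> \<epsilon>"
        then show "\<gamma> \<le> - 1 * (cdf P1 x - cdf P0 x)"
          using sep[of "1 - l" x] by (simp add: add.commute)
      qed (use pos in auto)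
    qed
  qed
qed

text \<open>A randomiser in [0, 1] lets each tie count for something between nothing and a full
  observation.\<close>

lemma seq_rank_bounds:
  assumes "r \<ge> 1" "u r \<in> {0..1}"
  shows "1 - (\<Sum>j\<in>{1..r}. of_bool (y j \<le> y r)) / real r \<le> seq_rank y u r"
    and "seq_rank y u r \<le> 1 - (\<Sum>j\<in>{1..r}. of_bool (y j < y r)) / real r"
proof -
  have "1 - (\<Sum>j\<in>{1..r}. of_bool (y j \<le> y r)) / real r = (\<Sum>j\<in>{1..r}. 1 - of_bool (y j \<le> y r)) / real r"
    using assms by (simp add: sum_subtractf diff_divide_distrib)
  also have "\<dots> \<le> seq_rank y u r" unfolding seq_rank_def
    using assms by (intro divide_right_mono sum_mono) auto
  finally show "1 - (\<Sum>j\<in>{1..r}. of_bool (y j \<le> y r)) / real r \<le> seq_rank y u r" .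
  have "seq_rank y u r \<le> (\<Sum>j\<in>{1..r}. 1 - of_bool (y j < y r)) / real r" unfolding seq_rank_def
    using assms by (intro divide_right_mono sum_mono) auto
  also have "\<dots> = 1 - (\<Sum>j\<in>{1..r}. of_bool (y j < y r)) / real r"
    using assms by (simp add: sum_subtractf diff_divide_distrib)
  finally show "seq_rank y u r \<le> 1 - (\<Sum>j\<in>{1..r}. of_bool (y j < y r)) / real r" .
qed

text \<open>The bound is free of m: it keeps the expected number of unreliable positions
  bounded.\<close>

lemma sum_exp_le_geometric:
  fixes b :: real
  assumes "b > 0"
  shows "(\<Sum>r\<in>{1..m}. exp (- b * real r)) \<le> 1 / (1 - exp (- b))"
proof -
  define x where "x = exp (- b)"
  have x: "0 < x" "x < 1" using assms by (auto simp: x_def)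
  have "(\<Sum>r\<in>{1..m}. exp (- b * real r)) = (\<Sum>r\<in>{1..m}. x ^ r)"
    by (simp add: x_def exp_of_nat_mult[symmetric] mult.commute)
  also have "\<dots> \<le> (\<Sum>r<Suc m. x ^ r)" using x by (intro sum_mono2) auto
  also have "\<dots> = (1 - x ^ Suc m) / (1 - x)" using x by (subst sum_gp_strict) auto
  also have "\<dots> \<le> 1 / (1 - x)" using x by (intro divide_right_mono) auto
  finally show ?thesis by (simp add: x_def)
qed

context randomised_data
begin

lemma U_in_unit_interval: "AE \<omega> in M. \<forall>r\<in>{1..m}. U r \<omega> \<in> {0..1}"
proof (intro AE_finite_allI)
  fix r assume r: "r \<in> {1..m}"
  have "AE u in distr M borel (U r). u \<in> {0<..<1}" unfolding distr_U[OF r] by (rule AE_unif01)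
  then have "AE \<omega> in M. U r \<omega> \<in> {0<..<1}" using r by (subst (asm) AE_distr_iff) auto
  then show "AE \<omega> in M. U r \<omega> \<in> {0..1}" by eventually_elim auto
qed simp

text \<open>Outside a small event, the rank \<open>p\<close> of position \<open>r\<close> is within \<open>e\<close> of \<open>1 - H r (Y r)\<close>, where
  \<open>H r\<close> is the average of the first \<open>r\<close> distribution functions. Hence \<open>p \<le> 1 - \<zeta>\<close> compares with
  the event \<open>H r (Y r) \<ge> v\<close> for \<open>v = \<zeta> - s e\<close>, and these events are independent in \<open>r\<close>. Their
  probabilities fall short of \<open>1 - \<zeta>\<close>, in the direction \<open>s\<close>, by at least \<open>k \<gamma> / r\<close> after the
  change point, up to \<open>e\<close>.\<close>

lemma KS_large_after_change:
  assumes P0: "real_distribution P0" "\<And>x. isCont (cdf P0) x"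
    and P1: "real_distribution P1" "\<And>x. isCont (cdf P1) x"
    and Y: "\<And>j. j \<in> {1..m} \<Longrightarrow> distr M borel (Y j) = (if j \<le> k then P0 else P1)"
    and km: "k \<le> m" "m \<ge> 1" and \<kappa>: "\<kappa> > 0" "\<kappa> \<le> (real k / real m) * (1 - real k / real m)"
    and s: "s = 1 \<or> s = - 1" and pos: "\<epsilon> > 0" "\<gamma> > 0" and \<zeta>: "0 < \<zeta> - \<epsilon>" "\<zeta> + \<epsilon> < 1"
    and sep: "\<And>l x. 0 \<le> l \<Longrightarrow> l \<le> 1 \<Longrightarrow> \<bar>l * cdf P0 x + (1 - l) * cdf P1 x - \<zeta>\<bar> \<le> \<epsilon> \<Longrightarrow>
      \<gamma> \<le> s * (cdf P1 x - cdf P0 x)"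
    and e: "e > 0" "e \<le> \<epsilon>" "e \<le> \<kappa> * \<gamma> / 8" and N: "N > 0" "2 / real N \<le> e"
  shows "\<exists>B\<in>events. prob B \<le> (16 * real N / (\<kappa> * \<gamma> * (1 - exp (- (e\<^sup>2 / 2)))) + 64 / (\<kappa> * \<gamma>)\<^sup>2) / real m \<and>
    (\<forall>\<omega>\<in>space M - B. \<kappa> * \<gamma> / 2 \<le> KS (ecdf {1..m} (seq_rank (\<lambda>j. Y j \<omega>) (\<lambda>j. U j \<omega>))))"
proof -
  define g where "g = \<kappa> * \<gamma>"
  have g: "g > 0" using \<kappa> pos by (simp add: g_def)
  define F where "F j = cdf (distr M borel (Y j))" for j
  define H where "H r x = (\<Sum>j\<in>{1..r}. F j x) / real r" for r x
  \<comment> \<open>The level is moved by e against the sign s, so that an error of at most e in a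
    rank can only help in the one-sided \<open>compare\<close> below.\<close>
  define v where "v = \<zeta> - s * e"
  have v: "0 < v" "v < 1" "\<bar>v - \<zeta>\<bar> = e" using s e \<zeta> by (auto simp: v_def)
  have F_eq: "F j = (if j \<le> k then cdf P0 else cdf P1)" if "j \<in> {1..m}" for j
    using Y[OF that] by (simp add: F_def)
  have F_cont: "isCont (F j) x" if "j \<in> {1..m}" for j x using F_eq[OF that] P0 P1 by simp
  have distr_Y: "real_distribution (distr M borel (Y j))" if "j \<in> {1..m}" for j
    using that by (intro real_distribution_distr measurable_Y)
  have H_mix: "H r x = (real (min k r) / real r) * cdf P0 x + (1 - real (min k r) / real r) * cdf P1 x"
    if r: "r \<in> {1..m}" for r x
  proof -
    have "(\<Sum>j\<in>{1..r}. F j x) = (\<Sum>j\<in>{1..r}. if j \<in> {1..min k r} then cdf P0 x else cdf P1 x)"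
      using r by (intro sum.cong) (auto simp: F_eq)
    also have "\<dots> = (\<Sum>j\<in>{1..min k r}. cdf P0 x) + (\<Sum>j\<in>{1..r} - {1..min k r}. cdf P1 x)"
    proof -
      have "{1..r} \<inter> {j. j \<in> {1..min k r}} = {1..min k r}" "{1..r} \<inter> - {j. j \<in> {1..min k r}} = {1..r} - {1..min k r}"
        by auto
      then show ?thesis by (subst sum.If_cases) (simp_all only: finite_atLeastAtMost)
    qed
    also have "\<dots> = real (min k r) * cdf P0 x + (real r - real (min k r)) * cdf P1 x"
      by (subst (2) sum_constant, subst card_Diff_subset) auto
    finally show ?thesis using r by (simp add: H_def field_simps)
  qed
  have H_dist: "\<exists>w. H r w = v \<and> {x. v \<le> H r x} = {w..}" if r: "r \<in> {1..m}" for r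
  proof -
    interpret P0: real_distribution P0 by fact
    interpret P1: real_distribution P1 by fact
    define l where "l = real (min k r) / real r"
    have l: "0 \<le> l" "l \<le> 1" using r by (auto simp: l_def)
    have Hl: "H r = (\<lambda>x. l * cdf P0 x + (1 - l) * cdf P1 x)" using H_mix[OF r] by (auto simp: l_def)
    have mono: "H r x \<le> H r y" if "x \<le> y" for x y
      unfolding Hl using l that by (intro add_mono mult_left_mono P0.cdf_nondecreasing P1.cdf_nondecreasing) auto
    have c: "isCont (H r) x" for x unfolding Hl using P0 P1 by (intro continuous_intros)
    have "((\<lambda>x. l * cdf P0 x + (1 - l) * cdf P1 x) \<longlongrightarrow> l * 0 + (1 - l) * 0) at_bot"
      by (intro tendsto_intros P0.cdf_lim_at_bot P1.cdf_lim_at_bot)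
    then have bot: "(H r \<longlongrightarrow> 0) at_bot" by (simp add: Hl)
    have "((\<lambda>x. l * cdf P0 x + (1 - l) * cdf P1 x) \<longlongrightarrow> l * 1 + (1 - l) * 1) at_top"
      by (intro tendsto_intros P0.cdf_lim_at_top_prob P1.cdf_lim_at_top_prob)
    then have top: "(H r \<longlongrightarrow> 1) at_top" by (simp add: Hl)
    show ?thesis using superlevel_set_of_continuous_cdf[OF mono c bot top v(1,2)] by blast
  qed
  then obtain w where w: "\<And>r. r \<in> {1..m} \<Longrightarrow> H r (w r) = v" "\<And>r. r \<in> {1..m} \<Longrightarrow> {x. v \<le> H r x} = {w r..}"
    by metis
  define b where "b r = measure (distr M borel (Y r)) {w r..}" for r
  \<comment> \<open>Up to position k the average \<open>H r\<close> is \<open>F r\<close> itself,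
    and only the shift of \<open>v\<close> is lost. Later, \<open>F r (w r) - v\<close> is k / r
    times the difference of the two distribution functions at \<open>w r\<close>.\<close>
  have b: "s * (1 - \<zeta> - b r) \<ge> - e + (if r \<le> k then 0 else real k / real m * \<gamma>)" if r: "r \<in> {1..m}" for r
  proof -
    interpret D: real_distribution "distr M borel (Y r)" by (rule distr_Y[OF r])
    have b_eq: "b r = 1 - F r (w r)"
      unfolding b_def F_def using F_cont[OF r] by (intro D.measure_Ici_eq) (simp add: F_def)
    have sv: "s * (v - \<zeta>) = - e" using s by (auto simp: v_def)
    show ?thesis
    proof (cases "r \<le> k")
      case True
      then have "F r (w r) = v" using w(1)[OF r] H_mix[OF r] F_eq[OF r] r by auto
      then show ?thesis using True sv by (simp add: b_eq)
    next
      case False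
      define l where "l = real k / real r"
      \<comment> \<open>The weight k / r of \<open>P0\<close> is smallest at r = m, which gives a
        lower bound common to all later positions.\<close>
      have l: "0 \<le> l" "l \<le> 1" "real k / real m \<le> l"
        using False r km by (auto simp: l_def intro!: divide_left_mono)
      have mix: "l * cdf P0 (w r) + (1 - l) * cdf P1 (w r) = v"
        using w(1)[OF r] H_mix[OF r, of "w r"] False by (simp add: l_def min_def)
      have "\<gamma> \<le> s * (cdf P1 (w r) - cdf P0 (w r))"
        using l mix v(3) e by (intro sep[of l]) auto
      then have "real k / real m * \<gamma> \<le> l * (s * (cdf P1 (w r) - cdf P0 (w r)))"
        using l pos by (intro mult_mono) auto
      also have "\<dots> = s * (cdf P1 (w r) - v)" unfolding mix[symmetric] by (simp add: algebra_simps)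
      finally have "real k / real m * \<gamma> - e \<le> s * (cdf P1 (w r) - v) + s * (v - \<zeta>)" using sv by linarith
      also have "\<dots> = s * (1 - \<zeta> - b r)" using False F_eq[OF r] by (simp add: b_eq algebra_simps)
      finally show ?thesis using False by simp
    qed
  qed
  have "\<exists>B\<in>events. prob B \<le> 2 * real N * exp (- (e\<^sup>2 / 2) * real (card {1..r})) \<and>
    (\<forall>\<omega>\<in>space M - B. \<forall>x. H r x - e \<le> (\<Sum>j\<in>{1..r}. of_bool (Y j \<omega> < x)) / real (card {1..r}) \<and>
       (\<Sum>j\<in>{1..r}. of_bool (Y j \<omega> \<le> x)) / real (card {1..r}) \<le> H r x + e)" if r: "r \<in> {1..m}" for r
  proof (rule Glivenko_Cantelli_bound[OF _ _ _ _ _ N e(1)])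
    show "indep_vars (\<lambda>_. borel) Y {1..r}" using r by (intro indep_vars_subset[OF indep_Y]) auto
    show "isCont (cdf (distr M borel (Y j))) x" if "j \<in> {1..r}" for j x
      using F_cont[of j x] that r by (simp add: F_def)
    show "{1..r} \<noteq> {}" using r by simp
  qed (simp_all add: H_def F_def)
  then have "\<forall>r\<in>{1..m}. \<exists>B. B \<in> events \<and> prob B \<le> 2 * real N * exp (- (e\<^sup>2 / 2) * real r) \<and>
    (\<forall>\<omega>\<in>space M - B. \<forall>x. H r x - e \<le> (\<Sum>j\<in>{1..r}. of_bool (Y j \<omega> < x)) / real r \<and>
       (\<Sum>j\<in>{1..r}. of_bool (Y j \<omega> \<le> x)) / real r \<le> H r x + e)"
    unfolding card_atLeastAtMost diff_Suc_1 by blast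
  from bchoice[OF this] obtain bad where bad: "\<And>r. r \<in> {1..m} \<Longrightarrow> bad r \<in> events"
      "\<And>r. r \<in> {1..m} \<Longrightarrow> prob (bad r) \<le> 2 * real N * exp (- (e\<^sup>2 / 2) * real r)"
    and good: "\<And>r \<omega> x. r \<in> {1..m} \<Longrightarrow> \<omega> \<in> space M - bad r \<Longrightarrow>
       H r x - e \<le> (\<Sum>j\<in>{1..r}. of_bool (Y j \<omega> < x)) / real r \<and>
       (\<Sum>j\<in>{1..r}. of_bool (Y j \<omega> \<le> x)) / real r \<le> H r x + e"
    by blast
  \<comment> \<open>More than a fraction g / 8 of unreliable positions; Markov's inequality suffices
    as their expected number is bounded.\<close>
  define B1 where "B1 = {\<omega>\<in>space M. real m * (g / 8) \<le> (\<Sum>r\<in>{1..m}. indicator (bad r) \<omega>)}"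
  have meas_bad: "(\<lambda>\<omega>. \<Sum>r\<in>{1..m}. indicator (bad r) \<omega> :: real) \<in> borel_measurable M"
    using bad(1) by (intro borel_measurable_sum borel_measurable_indicator)
  have int_bad: "integrable M (\<lambda>\<omega>. \<Sum>r\<in>{1..m}. indicator (bad r) \<omega> :: real)"
    using bad(1) by (intro Bochner_Integration.integrable_sum integrable_real_indicator) (auto simp: less_top[symmetric])
  have B1: "B1 \<in> events" unfolding B1_def using meas_bad by measurable
  have "prob B1 \<le> expectation (\<lambda>\<omega>. \<Sum>r\<in>{1..m}. indicator (bad r) \<omega>) / (real m * (g / 8))"
    unfolding B1_def using bad(1) g km int_bad
    by (intro integral_Markov_inequality_measure[where A="{}"]) (auto simp: sum_nonneg)
  also have "expectation (\<lambda>\<omega>. \<Sum>r\<in>{1..m}. indicator (bad r) \<omega>) = (\<Sum>r\<in>{1..m}. prob (bad r))"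
    using bad(1) sets.sets_into_space[OF bad(1)]
    by (subst Bochner_Integration.integral_sum)
      (auto intro!: sum.cong arg_cong[where f=prob] integrable_real_indicator simp: less_top[symmetric])
  also have "\<dots> \<le> (\<Sum>r\<in>{1..m}. 2 * real N * exp (- (e\<^sup>2 / 2) * real r))" using bad(2) by (intro sum_mono)
  also have "\<dots> = 2 * real N * (\<Sum>r\<in>{1..m}. exp (- (e\<^sup>2 / 2) * real r))" by (simp add: sum_distrib_left)
  also have "\<dots> \<le> 2 * real N * (1 / (1 - exp (- (e\<^sup>2 / 2))))"
    using e by (intro mult_left_mono sum_exp_le_geometric) auto
  also have "\<dots> / (real m * (g / 8)) = 16 * real N / (g * (1 - exp (- (e\<^sup>2 / 2)))) / real m"
    by (simp add: field_simps)
  finally have pB1: "prob B1 \<le> 16 * real N / (g * (1 - exp (- (e\<^sup>2 / 2)))) / real m"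
    using g km by (simp add: divide_right_mono)
  \<comment> \<open>The events \<open>Y r\<close> in \<open>{w r..}\<close> involve one observation
    each, so unlike the comparisons of the ranks themselves they are independent and Hoeffding
    applies.\<close>
  define B2 where "B2 = {\<omega>\<in>space M. g / 8 \<le> \<bar>(\<Sum>r\<in>{1..m}. of_bool (Y r \<omega> \<in> {w r..})) / real (card {1..m})
      - (\<Sum>r\<in>{1..m}. b r) / real (card {1..m})\<bar>}"
  have B2: "B2 \<in> events" "prob B2 \<le> 2 * exp (- 2 * (g / 8)\<^sup>2 * real (card {1..m}))"
    unfolding B2_def b_def using km g by (intro Hoeffding_of_bool indep_Y; simp)+
  \<comment> \<open>The exponential is weakened by exp (- c) <= 1 / c, which puts it in the common
    form constant / m.\<close>
  have "2 * exp (- 2 * (g / 8)\<^sup>2 * real m) \<le> 64 / g\<^sup>2 / real m"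
  proof -
    define c where "c = 2 * (g / 8)\<^sup>2 * real m"
    have c: "c > 0" using g km by (simp add: c_def)
    have "c \<le> exp c" using exp_ge_add_one_self[of c] by linarith
    then have "exp (- c) \<le> 1 / c"
      unfolding exp_minus inverse_eq_divide[of c, symmetric] using c by (rule le_imp_inverse_le)
    then have "2 * exp (- c) \<le> 2 / c" by simp
    also have "2 / c = 64 / g\<^sup>2 / real m" using g km by (simp add: c_def power2_eq_square field_simps)
    finally show ?thesis by (simp add: c_def)
  qed
  then have pB2: "prob B2 \<le> 64 / g\<^sup>2 / real m" using B2(2) by simp
  obtain B3 where B3': "{\<omega>\<in>space M. \<not> (\<forall>r\<in>{1..m}. U r \<omega> \<in> {0..1})} \<subseteq> B3" "emeasure M B3 = 0" "B3 \<in> events"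
    by (rule AE_E[OF U_in_unit_interval])
  then have B3: "{\<omega>\<in>space M. \<not> (\<forall>r\<in>{1..m}. U r \<omega> \<in> {0..1})} \<subseteq> B3" "B3 \<in> events" "prob B3 = 0"
    by (simp_all only: measure_def) simp
  define B where "B = B1 \<union> B2 \<union> B3"
  have B: "B \<in> events" using B1 B2 B3 by (simp add: B_def)
  have "prob B \<le> prob B1 + prob B2 + prob B3"
    unfolding B_def using measure_Un_le[of "B1 \<union> B2" M B3] measure_Un_le[of B1 M B2] B1 B2(1) B3(2) by simp
  then have pB: "prob B \<le> (16 * real N / (g * (1 - exp (- (e\<^sup>2 / 2)))) + 64 / g\<^sup>2) / real m"
    using pB1 pB2 B3 by (simp add: add_divide_distrib)
  have "g / 2 \<le> KS (ecdf {1..m} (seq_rank (\<lambda>j. Y j \<omega>) (\<lambda>j. U j \<omega>)))" if \<omega>: "\<omega> \<in> space M - B" for \<omega>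
  proof -
    define p where "p = seq_rank (\<lambda>j. Y j \<omega>) (\<lambda>j. U j \<omega>)"
    define ind where "ind r = (of_bool (Y r \<omega> \<in> {w r..}) :: real)" for r
    \<comment> \<open>For s = 1 a small rank forces \<open>H r (Y r) >= v\<close>; for s = - 1 the
      implication is reversed. A bad position costs at most 1.\<close>
    have compare: "s * (of_bool (p r \<le> 1 - \<zeta>) - ind r) \<le> indicator (bad r) \<omega>" if r: "r \<in> {1..m}" for r
    proof (cases "\<omega> \<in> bad r")
      case True
      then show ?thesis using s by (auto simp: ind_def)
    next
      case False
      have U: "U r \<omega> \<in> {0..1}" using \<omega> B3(1) r unfolding B_def by blast
      have p: "1 - H r (Y r \<omega>) - e \<le> p r" "p r \<le> 1 - H r (Y r \<omega>) + e"
        using seq_rank_bounds[of r "\<lambda>j. U j \<omega>" "\<lambda>j. Y j \<omega>"] good[OF r, of \<omega> "Y r \<omega>"] \<omega> False U r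
        unfolding p_def by (force simp: B_def)+
      have "Y r \<omega> \<in> {w r..} \<longleftrightarrow> v \<le> H r (Y r \<omega>)" unfolding w(2)[OF r, symmetric] by simp
      then have ind_iff: "ind r = of_bool (v \<le> H r (Y r \<omega>))" by (simp add: ind_def)
      from s show ?thesis
      proof
        assume "s = 1"
        then show ?thesis using p False by (auto simp: ind_iff v_def)
      next
        assume "s = - 1"
        then show ?thesis using p False by (auto simp: ind_iff v_def)
      qed
    qed
    define S where "S = (\<Sum>r\<in>{1..m}. of_bool (p r \<le> 1 - \<zeta>) :: real)"
    have 1: "s * (S - (\<Sum>r\<in>{1..m}. ind r)) \<le> real m * (g / 8)"
    proof -
      have "s * (S - (\<Sum>r\<in>{1..m}. ind r)) = (\<Sum>r\<in>{1..m}. s * (of_bool (p r \<le> 1 - \<zeta>) - ind r))"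
        by (simp add: S_def sum_subtractf sum_distrib_left right_diff_distrib)
      also have "\<dots> \<le> (\<Sum>r\<in>{1..m}. indicator (bad r) \<omega>)" using compare by (intro sum_mono)
      also have "\<dots> \<le> real m * (g / 8)" using \<omega> by (auto simp: B_def B1_def)
      finally show ?thesis .
    qed
    have 2: "\<bar>(\<Sum>r\<in>{1..m}. ind r) - (\<Sum>r\<in>{1..m}. b r)\<bar> \<le> real m * (g / 8)"
    proof -
      have "\<bar>(\<Sum>r\<in>{1..m}. ind r) / real m - (\<Sum>r\<in>{1..m}. b r) / real m\<bar> < g / 8"
        using \<omega> unfolding B_def B2_def ind_def by (simp add: not_le)
      then have "\<bar>(\<Sum>r\<in>{1..m}. ind r) - (\<Sum>r\<in>{1..m}. b r)\<bar> / real m < g / 8"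
        by (simp flip: diff_divide_distrib)
      then show ?thesis using km by (simp add: field_simps)
    qed
    \<comment> \<open>There are m - k positions after the change, each shifted by k / m times
      \<open>\<gamma>\<close>; the total is m \<open>\<gamma>\<close> times (k / m) (1 - k / m),
      which the hypothesis on \<open>\<kappa>\<close> bounds below by m g.\<close>
    have 3: "real m * (g - e) \<le> s * (real m * (1 - \<zeta>) - (\<Sum>r\<in>{1..m}. b r))"
    proof -
      have "real m * g \<le> real m * ((real k / real m * (1 - real k / real m)) * \<gamma>)"
        using \<kappa> pos unfolding g_def by (intro mult_left_mono mult_right_mono) auto
      also have "\<dots> = (real m - real k) * (real k / real m * \<gamma>)"
        using km by (simp add: field_simps)
      also have "\<dots> = (\<Sum>r\<in>{1..m}. if r \<le> k then 0 else real k / real m * \<gamma>)"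
      proof -
        have "{1..m} \<inter> - {r. r \<le> k} = {k<..m}" by auto
        then show ?thesis using km by (subst sum.If_cases) (auto simp: of_nat_diff)
      qed
      finally have "real m * (g - e) \<le> (\<Sum>r\<in>{1..m}. - e + (if r \<le> k then 0 else real k / real m * \<gamma>))"
        unfolding sum.distrib right_diff_distrib by simp
      also have "\<dots> \<le> (\<Sum>r\<in>{1..m}. s * (1 - \<zeta> - b r))" using b by (intro sum_mono)
      also have "\<dots> = s * (real m * (1 - \<zeta>) - (\<Sum>r\<in>{1..m}. b r))"
        by (simp add: sum_subtractf sum_distrib_left[symmetric])
      finally show ?thesis .
    qed
    \<comment> \<open>The losses are e from the shifted level and g / 8 each from bad positions and
      from sampling. As e is at most g / 8, at least 5 g / 8 remains.\<close>
    have "real m * (g / 2) \<le> real m * (g - e - g / 8 - g / 8)"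
      using e(3) g unfolding g_def[symmetric] by (intro mult_left_mono) linarith+
    also have "\<dots> = real m * (g - e) - real m * (g / 8) - real m * (g / 8)" by (simp add: right_diff_distrib)
    also have "\<dots> \<le> s * (real m * (1 - \<zeta>) - S)"
      using s
    proof
      assume "s = 1"
      then show ?thesis using 1 abs_le_D1[OF 2] abs_le_D2[OF 2] 3
        by (simp only: mult_1_left mult_minus1 minus_diff_eq)
    next
      assume "s = - 1"
      then show ?thesis using 1 abs_le_D1[OF 2] abs_le_D2[OF 2] 3
        by (simp only: mult_1_left mult_minus1 minus_diff_eq)
    qed
    finally have "g / 2 \<le> s * (real m * (1 - \<zeta>) - S) / real m" using km by (simp add: field_simps)
    also have "\<dots> = s * (1 - \<zeta> - S / real m)" using km by (simp add: field_simps)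
    also have "\<dots> \<le> \<bar>S / real m - (1 - \<zeta>)\<bar>" using s by auto
    also have "\<dots> = \<bar>ecdf {1..m} p (1 - \<zeta>) - cdf unif01 (1 - \<zeta>)\<bar>"
      using \<zeta> pos by (simp add: ecdf_def S_def cdf_unif01)
    also have "\<dots> \<le> KS (ecdf {1..m} p)" by (rule KS_ge)
    finally show ?thesis by (simp add: p_def)
  qed
  then show ?thesis using B pB unfolding g_def by (intro bexI[of _ B] conjI ballI) auto
qed

end

subsection \<open>The MCP test\<close>

text \<open>The constants are chosen before the probability space and the change position, since
  both vary with the row; only the lower bound \<open>\<kappa>\<close> on l (1 - l) ties them to the
  block.\<close>

lemma rank_test_power:
  assumes P0: "real_distribution P0" "\<And>x. isCont (cdf P0) x"
    and P1: "real_distribution P1" "\<And>x. isCont (cdf P1) x" and ne: "P0 \<noteq> P1"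
    and \<kappa>: "\<kappa> > 0" and u: "u > 0"
  shows "\<exists>C m0. \<forall>(M :: 'a measure) Y U m k. randomised_data M Y U m \<longrightarrow>
    (\<forall>j\<in>{1..m}. distr M borel (Y j) = (if j \<le> k then P0 else P1)) \<longrightarrow> k \<le> m \<longrightarrow> m \<ge> 1 \<longrightarrow> m \<ge> m0 \<longrightarrow>
    \<kappa> \<le> (real k / real m) * (1 - real k / real m) \<longrightarrow>
    1 - C / real m \<le> measure M {\<omega>\<in>space M. randomised_data.rank_pvalue Y U m \<omega> \<le> u}"
proof -
  obtain s \<zeta> \<epsilon> \<gamma> :: real where s: "s = 1 \<or> s = - 1" and pos: "\<epsilon> > 0" "\<gamma> > 0"
    and \<zeta>: "0 < \<zeta> - \<epsilon>" "\<zeta> + \<epsilon> < 1"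
    and sep: "\<And>l x. 0 \<le> l \<Longrightarrow> l \<le> 1 \<Longrightarrow> \<bar>l * cdf P0 x + (1 - l) * cdf P1 x - \<zeta>\<bar> \<le> \<epsilon> \<Longrightarrow>
      \<gamma> \<le> s * (cdf P1 x - cdf P0 x)"
    by (rule distinct_cdf_separation[OF P0 P1 ne]) (rule that, assumption+)
  \<comment> \<open>Small enough for the shifted level to stay in the separation band and for its
    cost to stay below an eighth of the gap.\<close>
  define e where "e = min \<epsilon> (\<kappa> * \<gamma> / 8)"
  have e: "e > 0" "e \<le> \<epsilon>" "e \<le> \<kappa> * \<gamma> / 8" using \<kappa> pos by (auto simp: e_def)
  obtain N :: nat where "2 / e < real N" using reals_Archimedean2 by blast
  then have N: "N > 0" "2 / real N \<le> e" using e(1) by (cases "N = 0"; auto simp: field_simps)+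
  define C where "C = 16 * real N / (\<kappa> * \<gamma> * (1 - exp (- (e\<^sup>2 / 2)))) + 64 / (\<kappa> * \<gamma>)\<^sup>2"
  have "eventually (\<lambda>m. 1 - u < KS_null_cdf m (sqrt (real m) * (\<kappa> * \<gamma> / 2))) sequentially"
    using \<kappa> pos u by (intro order_tendstoD(1)[OF KS_null_cdf_tendsto_1]) auto
  then obtain m0 where m0: "\<And>m. m \<ge> m0 \<Longrightarrow> 1 - u < KS_null_cdf m (sqrt (real m) * (\<kappa> * \<gamma> / 2))"
    by (auto simp: eventually_sequentially)
  show ?thesis
  proof (intro exI[of _ C] exI[of _ m0] allI impI)
    fix M :: "'a measure" and Y U m k
    assume "randomised_data M Y U m"
      and Y: "\<forall>j\<in>{1..m}. distr M borel (Y j) = (if j \<le> k then P0 else P1)"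
      and k: "k \<le> m" and m: "m \<ge> 1" "m \<ge> m0" and \<kappa>_le: "\<kappa> \<le> (real k / real m) * (1 - real k / real m)"
    then interpret randomised_data M Y U m by simp
    interpret D: real_distribution "KS_null m" by (rule real_distribution_KS_null)
    have "\<exists>B\<in>events. prob B \<le> C / real m \<and>
      (\<forall>\<omega>\<in>space M - B. \<kappa> * \<gamma> / 2 \<le> KS (ecdf {1..m} (seq_rank (\<lambda>j. Y j \<omega>) (\<lambda>j. U j \<omega>))))"
      unfolding C_def
      by (rule KS_large_after_change[OF P0 P1 _ k m(1) \<kappa> \<kappa>_le s pos \<zeta> sep e N]) (use Y in auto)
    then obtain B where B: "B \<in> events" "prob B \<le> C / real m"
      and large: "\<And>\<omega>. \<omega> \<in> space M - B \<Longrightarrow> \<kappa> * \<gamma> / 2 \<le> KS (ecdf {1..m} (seq_rank (\<lambda>j. Y j \<omega>) (\<lambda>j. U j \<omega>)))"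
      by blast
    have "1 - C / real m \<le> prob (space M - B)" using B by (simp add: prob_compl)
    also have "\<dots> \<le> prob {\<omega>\<in>space M. rank_pvalue \<omega> \<le> u}"
    proof (rule finite_measure_mono)
      show "space M - B \<subseteq> {\<omega>\<in>space M. rank_pvalue \<omega> \<le> u}"
      proof
        fix \<omega> assume \<omega>: "\<omega> \<in> space M - B"
        have "sqrt (real m) * (\<kappa> * \<gamma> / 2) \<le> rank_stat \<omega>"
          unfolding rank_stat_def by (intro mult_left_mono large[OF \<omega>]) simp
        then have "KS_null_cdf m (sqrt (real m) * (\<kappa> * \<gamma> / 2)) \<le> KS_null_cdf m (rank_stat \<omega>)"
          unfolding KS_null_cdf_eq by (rule D.cdf_nondecreasing)
        then show "\<omega> \<in> {\<omega>\<in>space M. rank_pvalue \<omega> \<le> u}"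
          using m0[OF m(2)] \<omega> by (simp add: rank_pvalue_def)
      qed
      show "{\<omega>\<in>space M. rank_pvalue \<omega> \<le> u} \<in> events" by measurable
    qed
    finally show "1 - C / real m \<le> prob {\<omega>\<in>space M. rank_pvalue \<omega> \<le> u}" .
  qed
qed

section \<open>The two blocks of a row as randomised samples\<close>

lemma randomised_data_left:
  assumes row: "changepoint_row M R Q n \<tau> X \<theta>" and t: "t \<in> {1..n-1}"
  shows "randomised_data M X (\<theta> t) t"
proof -
  interpret prob_space M using row by (simp add: changepoint_row_def)
  let ?Z = "case_sum X (\<lambda>(t, r). \<theta> t r)"
  \<comment> \<open>The injection of a block's indices into those of the row; it selects the
    randomisers drawn for the candidate t.\<close>
  let ?f = "case_sum Inl (\<lambda>r. Inr (t, r)) :: nat + nat \<Rightarrow> nat + nat \<times> nat"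
  have "indep_vars (\<lambda>_. borel) ?Z ({1..n} <+> {1..n-1} \<times> {1..n})"
    using row by (simp add: changepoint_row_def)
  moreover have "?f ` ({1..t} <+> {1..t}) \<subseteq> {1..n} <+> {1..n-1} \<times> {1..n}"
  proof (rule image_subsetI)
    fix k assume "k \<in> {1..t} <+> {1..t}"
    then show "?f k \<in> {1..n} <+> {1..n-1} \<times> {1..n}" using t by (elim PlusE) auto
  qed
  ultimately have "indep_vars (\<lambda>_. borel) ?Z (?f ` ({1..t} <+> {1..t}))" by (rule indep_vars_subset)
  then have "indep_vars (\<lambda>_. borel) (\<lambda>k. ?Z (?f k)) ({1..t} <+> {1..t})"
  proof (rule indep_vars_reindex[rotated])
    show "inj_on ?f ({1..t} <+> {1..t})"
      by (rule inj_onI, elim PlusE) auto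
  qed
  moreover have "(\<lambda>k. ?Z (?f k)) = case_sum X (\<theta> t)" by (rule ext, rename_tac k, case_tac k) simp_all
  ultimately show ?thesis
    using row t by unfold_locales (auto simp: changepoint_row_def)
qed

lemma randomised_data_right:
  assumes row: "changepoint_row M R Q n \<tau> X \<theta>" and t: "t \<in> {1..n-1}"
  shows "randomised_data M (\<lambda>j. X (n + 1 - j)) (\<lambda>j. \<theta> t (n + 1 - j)) (n - t)"
proof -
  interpret prob_space M using row by (simp add: changepoint_row_def)
  let ?Z = "case_sum X (\<lambda>(t, r). \<theta> t r)"
  \<comment> \<open>Reading backwards places the right block t + 1, ..., n at positions 1, ..., n -
    t, in the order in which its ranks accumulate.\<close>
  let ?f = "case_sum (\<lambda>j. Inl (n + 1 - j)) (\<lambda>j. Inr (t, n + 1 - j)) :: nat + nat \<Rightarrow> nat + nat \<times> nat"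
  have rev: "n + 1 - j \<in> {1..n}" if "j \<in> {1..n-t}" for j
    using that t unfolding atLeastAtMost_iff by linarith
  have "indep_vars (\<lambda>_. borel) ?Z ({1..n} <+> {1..n-1} \<times> {1..n})"
    using row by (simp add: changepoint_row_def)
  moreover have "?f ` ({1..n-t} <+> {1..n-t}) \<subseteq> {1..n} <+> {1..n-1} \<times> {1..n}"
  proof (rule image_subsetI)
    fix k assume "k \<in> {1..n-t} <+> {1..n-t}"
    then obtain j where "j \<in> {1..n-t}" and k: "k = Inl j \<or> k = Inr j" by blast
    then have "n + 1 - j \<in> {1..n}" by (intro rev)
    then show "?f k \<in> {1..n} <+> {1..n-1} \<times> {1..n}" using t k by (auto simp del: atLeastAtMost_iff)
  qed
  ultimately have "indep_vars (\<lambda>_. borel) ?Z (?f ` ({1..n-t} <+> {1..n-t}))" by (rule indep_vars_subset)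
  then have "indep_vars (\<lambda>_. borel) (\<lambda>k. ?Z (?f k)) ({1..n-t} <+> {1..n-t})"
  proof (rule indep_vars_reindex[rotated])
    show "inj_on ?f ({1..n-t} <+> {1..n-t})"
      by (rule inj_onI, elim PlusE) auto
  qed
  moreover have "(\<lambda>k. ?Z (?f k)) = case_sum (\<lambda>j. X (n + 1 - j)) (\<lambda>j. \<theta> t (n + 1 - j))"
    by (rule ext, rename_tac k, case_tac k) simp_all
  moreover have "distr M borel (\<theta> t (n + 1 - j)) = unif01" if "j \<in> {1..n-t}" for j
    using row t rev[OF that] by (simp add: changepoint_row_def)
  ultimately show ?thesis by unfold_locales auto
qed

lemma changepoint_row_distr_reversed:
  assumes row: "changepoint_row M R Q n \<tau> X \<theta>" and "\<tau> \<le> n" "j \<in> {1..n}"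
  shows "distr M borel (X (n + 1 - j)) = (if j \<le> n - \<tau> then Q else R)"
proof -
  have "n + 1 - j \<in> {1..n}" using assms(3) by auto
  moreover have "n + 1 - j \<le> \<tau> \<longleftrightarrow> \<not> j \<le> n - \<tau>"
    using assms(2,3) unfolding atLeastAtMost_iff by linarith
  ultimately show ?thesis using row by (simp add: changepoint_row_def)
qed

lemma mcp_rank_left: "r \<le> t \<Longrightarrow> mcp_rank n x \<theta> t r = seq_rank x (\<theta> t) r"
  by (simp add: mcp_rank_def seq_rank_def)

text \<open>For r = n + 1 - i the window r, ..., n has n - r + 1 = i elements and is the reversal of
  1, ..., i.\<close>

lemma mcp_rank_right:
  assumes "i \<in> {1..n-t}"
  shows "mcp_rank n x \<theta> t (n + 1 - i) = seq_rank (\<lambda>j. x (n + 1 - j)) (\<lambda>j. \<theta> t (n + 1 - j)) i"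
proof -
  let ?g = "\<lambda>j. of_bool (x j > x (n + 1 - i)) + \<theta> t (n + 1 - i) * of_bool (x j = x (n + 1 - i))"
  have bij: "bij_betw (\<lambda>j. n + 1 - j) {1..i} {n + 1 - i..n}"
    by (rule bij_betwI[where g="\<lambda>j. n + 1 - j"]) (use assms in auto)
  have "mcp_rank n x \<theta> t (n + 1 - i) = (\<Sum>j\<in>{n + 1 - i..n}. ?g j) / real i"
    using assms by (auto simp: mcp_rank_def)
  also have "\<dots> = (\<Sum>j\<in>{1..i}. ?g (n + 1 - j)) / real i" using sum.reindex_bij_betw[OF bij, of ?g] by simp
  finally show ?thesis by (simp add: seq_rank_def)
qed

lemma p_left_eq:
  assumes "randomised_data M X (\<theta> t) t"
  shows "p_left n (\<lambda>j. X j \<omega>) (\<lambda>s k. \<theta> s k \<omega>) t = randomised_data.rank_pvalue X (\<theta> t) t \<omega>"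
proof -
  interpret randomised_data M X "\<theta> t" t by fact
  have "ecdf {1..t} (mcp_rank n (\<lambda>j. X j \<omega>) (\<lambda>s k. \<theta> s k \<omega>) t) = ecdf {1..t} (seq_rank (\<lambda>j. X j \<omega>) (\<lambda>j. \<theta> t j \<omega>))"
    by (intro ecdf_cong) (simp add: mcp_rank_left)
  then show ?thesis by (simp add: p_left_def W_left_def rank_pvalue_def rank_stat_def)
qed

lemma p_right_eq:
  assumes "randomised_data M (\<lambda>j. X (n + 1 - j)) (\<lambda>j. \<theta> t (n + 1 - j)) (n - t)" and t: "t \<le> n"
  shows "p_right n (\<lambda>j. X j \<omega>) (\<lambda>s k. \<theta> s k \<omega>) t
    = randomised_data.rank_pvalue (\<lambda>j. X (n + 1 - j)) (\<lambda>j. \<theta> t (n + 1 - j)) (n - t) \<omega>"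
proof -
  interpret randomised_data M "\<lambda>j. X (n + 1 - j)" "\<lambda>j. \<theta> t (n + 1 - j)" "n - t" by fact
  let ?p = "mcp_rank n (\<lambda>j. X j \<omega>) (\<lambda>s k. \<theta> s k \<omega>) t"
  let ?q = "seq_rank (\<lambda>j. X (n + 1 - j) \<omega>) (\<lambda>j. \<theta> t (n + 1 - j) \<omega>)"
  have bij: "bij_betw (\<lambda>j. n + 1 - j) {1..n-t} {t+1..n}"
    by (rule bij_betwI[where g="\<lambda>j. n + 1 - j"]) (use t in auto)
  have "ecdf {t+1..n} ?p z = ecdf {1..n-t} ?q z" for z
  proof -
    have "(\<Sum>r\<in>{t+1..n}. of_bool (?p r \<le> z)) = (\<Sum>i\<in>{1..n-t}. of_bool (?p (n + 1 - i) \<le> z) :: real)"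
      using sum.reindex_bij_betw[OF bij, of "\<lambda>r. of_bool (?p r \<le> z) :: real"] by simp
    also have "\<dots> = (\<Sum>i\<in>{1..n-t}. of_bool (?q i \<le> z))"
      by (intro sum.cong refl) (simp only: mcp_rank_right)
    finally show ?thesis by (simp add: ecdf_def)
  qed
  then have "ecdf {t+1..n} ?p = ecdf {1..n-t} ?q" by auto
  then show ?thesis unfolding p_right_def W_right_def rank_pvalue_def rank_stat_def by simp
qed

text \<open>Below 1 the cap in the minimum never decides, which leaves a Bonferroni combination at
  half the level.\<close>

lemma p_CONF_le_iff:
  assumes "\<alpha> < 1"
  shows "p_CONF n x \<theta> t \<le> \<alpha> \<longleftrightarrow> p_left n x \<theta> t \<le> \<alpha> / 2 \<or> p_right n x \<theta> t \<le> \<alpha> / 2"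
  using assms by (auto simp: p_CONF_def min_le_iff_disj)

section \<open>Asymptotics of the change point indices\<close>

lemma cp_index_bounds:
  assumes "0 \<le> c"
  shows "c * real n - 1 < real (cp_index c n)" "real (cp_index c n) \<le> c * real n"
proof -
  have "0 \<le> \<lfloor>c * real n\<rfloor>" using assms by simp
  then have "real (cp_index c n) = real_of_int \<lfloor>c * real n\<rfloor>" by (simp add: cp_index_def)
  then show "c * real n - 1 < real (cp_index c n)" "real (cp_index c n) \<le> c * real n" by linarith+
qed

lemma cp_index_mono: "c \<le> c' \<Longrightarrow> cp_index c n \<le> cp_index c' n"
  unfolding cp_index_def by (intro nat_mono floor_mono mult_right_mono) auto

lemma cp_index_ratio_tendsto:
  assumes "0 \<le> c"
  shows "(\<lambda>n. real (cp_index c n) / real n) \<longlonglongrightarrow> c"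
proof (rule tendsto_sandwich)
  have "(\<lambda>n. c - 1 / real n) \<longlonglongrightarrow> c - 0" by (intro tendsto_intros lim_1_over_n)
  then show "(\<lambda>n. c - 1 / real n) \<longlonglongrightarrow> c" by simp
  show "(\<lambda>n. c) \<longlonglongrightarrow> c" by simp
  show "eventually (\<lambda>n. c - 1 / real n \<le> real (cp_index c n) / real n) sequentially"
    using eventually_gt_at_top[of 0]
  proof eventually_elim
    case (elim n)
    have "c - 1 / real n = (c * real n - 1) / real n" using elim by (simp add: field_simps)
    also have "\<dots> \<le> real (cp_index c n) / real n"
      using cp_index_bounds(1)[OF assms, of n] by (intro divide_right_mono) auto
    finally show ?case .
  qed
  show "eventually (\<lambda>n. real (cp_index c n) / real n \<le> c) sequentially"
    using eventually_gt_at_top[of 0]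
  proof eventually_elim
    case (elim n)
    then show ?case using cp_index_bounds(2)[OF assms, of n] by (simp add: field_simps)
  qed
qed

text \<open>The model constrains a row only for these n, while consistency is a limit. The ratios to
  n tend to distinct limits inside (0, 1).\<close>

lemma eventually_large_enough:
  assumes c: "c \<in> {0<..<1}" "c' \<in> {0<..<1}" "c \<noteq> c'"
  shows "eventually (large_enough c c') sequentially"
proof -
  have ev: "eventually (\<lambda>n. cp_index a n \<in> {1..n-1}) sequentially" if a: "a \<in> {0<..<1}" for a
  proof -
    have lim: "(\<lambda>n. real (cp_index a n) / real n) \<longlonglongrightarrow> a" using a by (intro cp_index_ratio_tendsto) auto
    have "eventually (\<lambda>n. 0 < real (cp_index a n) / real n) sequentially"
      "eventually (\<lambda>n. real (cp_index a n) / real n < 1) sequentially"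
      using order_tendstoD[OF lim] a by auto
    then show ?thesis using eventually_gt_at_top[of 0]
      by eventually_elim (auto simp: field_simps zero_less_divide_iff)
  qed
  have "(\<lambda>n. real (cp_index c n) / real n - real (cp_index c' n) / real n) \<longlonglongrightarrow> c - c'"
    using c by (intro tendsto_diff cp_index_ratio_tendsto) auto
  then have "eventually (\<lambda>n. real (cp_index c n) / real n - real (cp_index c' n) / real n \<noteq> 0) sequentially"
    using c by (intro tendsto_imp_eventually_ne) auto
  with ev[OF c(1)] ev[OF c(2)] show ?thesis
    unfolding large_enough_def by eventually_elim auto
qed

section \<open>Continuity and distinctness of the two distributions\<close>

lemma density_distribution_continuous:
  assumes "real_distribution P" "P = density lborel (\<lambda>x. ennreal (p x))" "continuous_on UNIV p"
  shows "isCont (cdf P) x"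
proof -
  interpret real_distribution P by fact
  have [measurable]: "p \<in> borel_measurable borel" using assms(3) by (rule borel_measurable_continuous_onI)
  have "AE y in lborel. y \<noteq> x" by (rule AE_lborel_singleton)
  then have "AE y in lborel. y \<in> {x} \<longrightarrow> ennreal (p y) \<le> 0" by eventually_elim auto
  then have "{x} \<in> null_sets P" unfolding assms(2)
    by (subst null_sets_density_iff) auto
  then have "measure P {x} = 0" by (simp add: null_sets_def measure_def)
  then show ?thesis by (simp add: isCont_cdf)
qed

text \<open>The derivative of R with respect to itself is 1 almost everywhere. Both expectations are
  then 1, and the weights add up to 1 in numerator and denominator.\<close>

lemma changepoint_condition_imp_distinct:
  assumes "real_distribution R" "f \<in> borel_measurable borel" "AE x in R. f x = RN_deriv R Q x"
    and cond: "changepoint_condition R Q f a"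
  shows "R \<noteq> Q"
proof
  assume RQ: "R = Q"
  interpret real_distribution R by fact
  have "AE x in R. 1 = RN_deriv R R x"
    by (rule RN_deriv_unique) (auto simp: density_1)
  with assms(3) have "AE x in R. f x = 1" unfolding RQ[symmetric] by eventually_elim simp
  then have "(\<integral>z. enn2real (f z) \<partial>R) = (\<integral>z. 1 \<partial>R)"
    using assms(2) by (intro integral_cong_AE) auto
  then have "(\<integral>z. enn2real (f z) \<partial>R) = 1" using prob_space by simp
  then have "score_ratio R Q (\<lambda>z. enn2real (f z)) a \<delta> q = 1" for \<delta> q
    by (simp add: score_ratio_def RQ[symmetric])
  then show False using cond by (auto simp: changepoint_condition_def)
qed

lemma integral_mcp_test:
  assumes row: "changepoint_row M R Q n \<tau> X \<theta>" and t: "t \<in> {1..n-1}" and \<alpha>: "\<alpha> < 1"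
  defines "pl \<equiv> randomised_data.rank_pvalue X (\<theta> t) t"
    and "pr \<equiv> randomised_data.rank_pvalue (\<lambda>j. X (n + 1 - j)) (\<lambda>j. \<theta> t (n + 1 - j)) (n - t)"
  shows "(\<integral>\<omega>. mcp_test n \<alpha> t (\<lambda>j. X j \<omega>) (\<lambda>s k. \<theta> s k \<omega>) \<partial>M)
    = measure M ({\<omega>\<in>space M. pl \<omega> \<le> \<alpha> / 2} \<union> {\<omega>\<in>space M. pr \<omega> \<le> \<alpha> / 2})"
proof -
  note L = randomised_data_left[OF row t] and Rt = randomised_data_right[OF row t]
  have "t \<le> n" using t by auto
  have "(\<integral>\<omega>. mcp_test n \<alpha> t (\<lambda>j. X j \<omega>) (\<lambda>s k. \<theta> s k \<omega>) \<partial>M)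
      = (\<integral>\<omega>. indicator ({\<omega>\<in>space M. pl \<omega> \<le> \<alpha> / 2} \<union> {\<omega>\<in>space M. pr \<omega> \<le> \<alpha> / 2}) \<omega> \<partial>M)"
    by (intro Bochner_Integration.integral_cong refl)
       (auto simp: mcp_test_eq[OF t] p_CONF_le_iff[OF \<alpha>] p_left_eq[of M X \<theta> t, OF L] p_right_eq[of M X n \<theta> t, OF Rt \<open>t \<le> n\<close>] pl_def pr_def indicator_def)
  then show ?thesis by (simp add: Int_absorb2)
qed

theorem proposition7:
  fixes R Q :: "real measure"
    and f :: "real \<Rightarrow> ennreal"
    and r q :: "real \<Rightarrow> real"
    and c c' \<alpha> :: real
    and M :: "nat \<Rightarrow> 'a measure"
    and X :: "nat \<Rightarrow> nat \<Rightarrow> 'a \<Rightarrow> real"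
    and \<theta> :: "nat \<Rightarrow> nat \<Rightarrow> nat \<Rightarrow> 'a \<Rightarrow> real"
    and \<tau> :: "nat \<Rightarrow> nat"
  defines "t \<equiv> cp_index c" and "t' \<equiv> cp_index c'"
  defines "\<phi> \<equiv> \<lambda>n \<omega>. mcp_test n \<alpha> (t n) (\<lambda>j. X n j \<omega>) (\<lambda>s k. \<theta> n s k \<omega>)"
  assumes "real_distribution R" and "real_distribution Q"
    and "absolutely_continuous R Q"
    and "f \<in> borel_measurable borel"
    and "AE x in R. f x = RN_deriv R Q x"
    and "\<forall>x. f x < \<infinity>"
    and "c \<in> {0<..<1}" and "c' \<in> {0<..<1}" and "c \<noteq> c'"
    and "\<alpha> \<in> {0<..<1}"
    and "\<forall>n. large_enough c c' n \<longrightarrow> changepoint_row (M n) R Q n (\<tau> n) (X n) (\<theta> n)"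
    and "continuous_on UNIV r" and "\<forall>x. r x \<ge> 0" and "R = density lborel (\<lambda>x. ennreal (r x))"
    and "continuous_on UNIV q" and "\<forall>x. q x \<ge> 0" and "Q = density lborel (\<lambda>x. ennreal (q x))"
    and "(\<integral>\<^sup>+z. (f z)\<^sup>2 \<partial>Q) < \<infinity>" and "(\<integral>\<^sup>+z. (f z)\<^sup>2 \<partial>R) < \<infinity>"
  shows "(changepoint_condition R Q f c \<longrightarrow>
            (\<forall>n. large_enough c c' n \<and> \<tau> n = t n \<longrightarrow> (\<integral>\<omega>. \<phi> n \<omega> \<partial>M n) \<le> \<alpha>)) \<and>
         (changepoint_condition R Q f c' \<longrightarrow>
            (\<forall>n. large_enough c c' n \<longrightarrow> \<tau> n = t' n) \<longrightarrow>
            (\<lambda>n. \<integral>\<omega>. \<phi> n \<omega> \<partial>M n) \<longlonglongrightarrow> 1)"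
proof -
  note R = assms(4) and Q = assms(5)
  have contR: "isCont (cdf R) x" for x using assms(4,17,15) by (rule density_distribution_continuous)
  have contQ: "isCont (cdf Q) x" for x using assms(5,20,18) by (rule density_distribution_continuous)
  have c: "c \<in> {0<..<1}" "c' \<in> {0<..<1}" "c \<noteq> c'" and \<alpha>: "\<alpha> \<in> {0<..<1}" using assms by auto
  have row: "changepoint_row (M n) R Q n (\<tau> n) (X n) (\<theta> n)" if "large_enough c c' n" for n
    using assms(14) that by blast
  define pl where "pl n = randomised_data.rank_pvalue (X n) (\<theta> n (t n)) (t n)" for n
  define pr where "pr n = randomised_data.rank_pvalue (\<lambda>j. X n (n + 1 - j)) (\<lambda>j. \<theta> n (t n) (n + 1 - j)) (n - t n)" for n
  have tn: "t n \<in> {1..n-1}" "t' n \<in> {1..n-1}" "t n \<noteq> t' n" if "large_enough c c' n" for n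
    using that by (auto simp: large_enough_def t_def t'_def)
  have int: "(\<integral>\<omega>. \<phi> n \<omega> \<partial>M n)
      = measure (M n) ({\<omega>\<in>space (M n). pl n \<omega> \<le> \<alpha> / 2} \<union> {\<omega>\<in>space (M n). pr n \<omega> \<le> \<alpha> / 2})"
    if "large_enough c c' n" for n
    unfolding \<phi>_def pl_def pr_def using \<alpha> integral_mcp_test[OF row[OF that] tn(1)[OF that], of \<alpha>] by simp
  have meas: "{\<omega>\<in>space (M n). pl n \<omega> \<le> \<alpha> / 2} \<in> sets (M n)" "{\<omega>\<in>space (M n). pr n \<omega> \<le> \<alpha> / 2} \<in> sets (M n)"
    if n: "large_enough c c' n" for n
  proof -
    interpret L: randomised_data "M n" "X n" "\<theta> n (t n)" "t n" by (rule randomised_data_left[OF row[OF n] tn(1)[OF n]])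
    interpret Rt: randomised_data "M n" "\<lambda>j. X n (n + 1 - j)" "\<lambda>j. \<theta> n (t n) (n + 1 - j)" "n - t n"
      by (rule randomised_data_right[OF row[OF n] tn(1)[OF n]])
    show "{\<omega>\<in>space (M n). pl n \<omega> \<le> \<alpha> / 2} \<in> sets (M n)"
      unfolding pl_def by measurable
    show "{\<omega>\<in>space (M n). pr n \<omega> \<le> \<alpha> / 2} \<in> sets (M n)"
      unfolding pr_def by measurable
  qed
  have level: "(\<integral>\<omega>. \<phi> n \<omega> \<partial>M n) \<le> \<alpha>" if n: "large_enough c c' n" and \<tau>: "\<tau> n = t n" for n
  proof -
    interpret L: randomised_data "M n" "X n" "\<theta> n (t n)" "t n" by (rule randomised_data_left[OF row[OF n] tn(1)[OF n]])
    interpret Rt: randomised_data "M n" "\<lambda>j. X n (n + 1 - j)" "\<lambda>j. \<theta> n (t n) (n + 1 - j)" "n - t n"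
      by (rule randomised_data_right[OF row[OF n] tn(1)[OF n]])
    have "L.prob {\<omega>\<in>space (M n). pl n \<omega> \<le> \<alpha> / 2} = \<alpha> / 2"
      unfolding pl_def using row[OF n] tn[OF n] \<alpha> \<tau>
      by (intro L.prob_rank_pvalue_le[OF R contR]) (auto simp: changepoint_row_def)
    moreover have "L.prob {\<omega>\<in>space (M n). pr n \<omega> \<le> \<alpha> / 2} = \<alpha> / 2"
      unfolding pr_def
    proof (rule Rt.prob_rank_pvalue_le[OF Q contQ])
      show "distr (M n) borel (X n (n + 1 - j)) = Q" if "j \<in> {1..n - t n}" for j
        using changepoint_row_distr_reversed[OF row[OF n], of j] that tn[OF n] \<tau> by auto
      show "1 \<le> n - t n" using tn(1)[OF n] by auto
    qed (use \<alpha> in auto)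
    moreover have "L.prob ({\<omega>\<in>space (M n). pl n \<omega> \<le> \<alpha> / 2} \<union> {\<omega>\<in>space (M n). pr n \<omega> \<le> \<alpha> / 2})
        \<le> L.prob {\<omega>\<in>space (M n). pl n \<omega> \<le> \<alpha> / 2} + L.prob {\<omega>\<in>space (M n). pr n \<omega> \<le> \<alpha> / 2}"
      using meas[OF n] by (rule measure_Un_le)
    ultimately show ?thesis by (simp add: int[OF n])
  qed
  have power: "(\<lambda>n. \<integral>\<omega>. \<phi> n \<omega> \<partial>M n) \<longlonglongrightarrow> 1"
    if ne: "R \<noteq> Q" and \<tau>: "\<forall>n. large_enough c c' n \<longrightarrow> \<tau> n = t' n"
  proof -
    note large = eventually_large_enough[OF c]
    have lim: "(\<lambda>n. real (t n) / real n) \<longlonglongrightarrow> c" "(\<lambda>n. real (t' n) / real n) \<longlonglongrightarrow> c'"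
      unfolding t_def t'_def using c by (auto intro!: cp_index_ratio_tendsto)
    \<comment> \<open>A block length proportional to n turns the error C / m into a null sequence; 1
      is an upper bound since the expectation is a probability.\<close>
    have conclude: "(\<lambda>n. \<integral>\<omega>. \<phi> n \<omega> \<partial>M n) \<longlonglongrightarrow> 1"
      if mn: "(\<lambda>n. real (mn n) / real n) \<longlonglongrightarrow> a" "a > 0"
        and ev: "eventually (\<lambda>n. 1 - C / real (mn n) \<le> (\<integral>\<omega>. \<phi> n \<omega> \<partial>M n)) sequentially"
      for mn :: "nat \<Rightarrow> nat" and a C :: real
    proof (rule tendsto_sandwich[OF ev _ _ tendsto_const])
      show "eventually (\<lambda>n. (\<integral>\<omega>. \<phi> n \<omega> \<partial>M n) \<le> 1) sequentially"
        using large
      proof eventually_elim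
        case (elim n)
        interpret prob_space "M n" using row[OF elim] by (simp add: changepoint_row_def)
        show ?case by (simp add: int[OF elim])
      qed
      have "(\<lambda>n. 1 - C / real n / (real (mn n) / real n)) \<longlonglongrightarrow> 1 - 0 / a"
        using mn by (intro tendsto_intros lim_const_over_n) auto
      moreover have "eventually (\<lambda>n. 1 - C / real n / (real (mn n) / real n) = 1 - C / real (mn n)) sequentially"
        using eventually_gt_at_top[of 0] by eventually_elim simp
      ultimately have "(\<lambda>n. 1 - C / real (mn n)) \<longlonglongrightarrow> 1 - 0 / a"
        by (rule Lim_transform_eventually)
      then show "(\<lambda>n. 1 - C / real (mn n)) \<longlonglongrightarrow> 1" by simp
    qed
    \<comment> \<open>Half of the limit of l (1 - l), for l the fraction of the block before the
      change, is eventually a lower bound. This is the origin of both values of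
      \<open>\<kappa>\<close> below.\<close>
    have ratio: "eventually (\<lambda>n. a / b * (1 - a / b) / 2 \<le> real (kn n) / real (mn n) * (1 - real (kn n) / real (mn n))) sequentially
        \<and> eventually (\<lambda>n. mn n \<ge> m0) sequentially"
      if kn: "(\<lambda>n. real (kn n) / real n) \<longlonglongrightarrow> a" and mn: "(\<lambda>n. real (mn n) / real n) \<longlonglongrightarrow> b"
        and ab: "0 < a" "a < b" for kn mn :: "nat \<Rightarrow> nat" and a b and m0
    proof
      have half: "x / 2 < x" if "0 < x" for x :: real using that by simp
      have "(\<lambda>n. (real (kn n) / real n) / (real (mn n) / real n)) \<longlonglongrightarrow> a / b"
        using kn mn ab by (intro tendsto_intros) auto
      moreover have "eventually (\<lambda>n. (real (kn n) / real n) / (real (mn n) / real n) = real (kn n) / real (mn n)) sequentially"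
        using eventually_gt_at_top[of 0] by eventually_elim simp
      ultimately have "(\<lambda>n. real (kn n) / real (mn n)) \<longlonglongrightarrow> a / b"
        by (rule Lim_transform_eventually)
      then have "(\<lambda>n. real (kn n) / real (mn n) * (1 - real (kn n) / real (mn n))) \<longlonglongrightarrow> a / b * (1 - a / b)"
        by (intro tendsto_mult tendsto_diff tendsto_const)
      moreover have "a / b * (1 - a / b) > 0" using ab by (intro mult_pos_pos) (auto simp: field_simps)
      ultimately have "eventually (\<lambda>n. a / b * (1 - a / b) / 2 < real (kn n) / real (mn n) * (1 - real (kn n) / real (mn n))) sequentially"
        by (elim order_tendstoD(1)) (rule half)
      then show "eventually (\<lambda>n. a / b * (1 - a / b) / 2 \<le> real (kn n) / real (mn n) * (1 - real (kn n) / real (mn n))) sequentially"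
        by eventually_elim simp
      have "filterlim (\<lambda>n. (real (mn n) / real n) * real n) at_top sequentially"
        using mn ab by (intro filterlim_tendsto_pos_mult_at_top[OF mn]) (auto intro: filterlim_real_sequentially)
      then have "eventually (\<lambda>n. real m0 \<le> (real (mn n) / real n) * real n) sequentially"
        by (auto simp: filterlim_at_top)
      then show "eventually (\<lambda>n. mn n \<ge> m0) sequentially"
        using eventually_gt_at_top[of 0] by eventually_elim simp
    qed
    show ?thesis
    proof (cases "c' < c")
      case True
      \<comment> \<open>The change lies inside the left block, whose first \<open>t' n\<close> out
        of \<open>t n\<close> observations come from R.\<close>
      define \<kappa> where "\<kappa> = c' / c * (1 - c' / c) / 2"
      have \<kappa>: "\<kappa> > 0" unfolding \<kappa>_def using c True by (intro divide_pos_pos mult_pos_pos) (auto simp: field_simps)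
      have "\<alpha> / 2 > 0" using \<alpha> by simp
      from rank_test_power[OF R contR Q contQ ne \<kappa> this, where 'a='a]
      obtain C m0 where C: "\<forall>(M :: 'a measure) Y U m k. randomised_data M Y U m \<longrightarrow>
        (\<forall>j\<in>{1..m}. distr M borel (Y j) = (if j \<le> k then R else Q)) \<longrightarrow> k \<le> m \<longrightarrow> m \<ge> 1 \<longrightarrow> m \<ge> m0 \<longrightarrow>
        \<kappa> \<le> (real k / real m) * (1 - real k / real m) \<longrightarrow>
        1 - C / real m \<le> measure M {\<omega>\<in>space M. randomised_data.rank_pvalue Y U m \<omega> \<le> \<alpha> / 2}"
        by (elim exE) (rule that)
      have ev: "eventually (\<lambda>n. \<kappa> \<le> real (t' n) / real (t n) * (1 - real (t' n) / real (t n))) sequentially"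
        "eventually (\<lambda>n. t n \<ge> m0) sequentially"
        using ratio[OF lim(2) lim(1), of m0] c True by (auto simp: \<kappa>_def)
      have "eventually (\<lambda>n. 1 - C / real (t n) \<le> (\<integral>\<omega>. \<phi> n \<omega> \<partial>M n)) sequentially"
        using ev large
      proof eventually_elim
        case (elim n)
        interpret prob_space "M n" using row[OF elim(3)] by (simp add: changepoint_row_def)
        have "t' n \<le> t n" unfolding t_def t'_def using True by (intro cp_index_mono) simp
        then have "1 - C / real (t n) \<le> prob {\<omega>\<in>space (M n). pl n \<omega> \<le> \<alpha> / 2}"
          unfolding pl_def using row[OF elim(3)] tn[OF elim(3)] \<tau> elim
          by (intro C[rule_format, where k="t' n"] randomised_data_left[OF row[OF elim(3)]]) (auto simp: changepoint_row_def)
        also have "\<dots> \<le> prob ({\<omega>\<in>space (M n). pl n \<omega> \<le> \<alpha> / 2} \<union> {\<omega>\<in>space (M n). pr n \<omega> \<le> \<alpha> / 2})"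
          using meas[OF elim(3)] by (intro finite_measure_mono) auto
        finally show ?case by (simp add: int[OF elim(3)])
      qed
      then show ?thesis using lim(1) c by (intro conclude[of t c C]) auto
    next
      case False
      then have cc: "c < c'" using c by simp
      \<comment> \<open>The change lies inside the right block, which read backwards starts with
        \<open>n - t' n\<close> observations from Q; hence the exchanged distributions
        below.\<close>
      define \<kappa> where "\<kappa> = (1 - c') / (1 - c) * (1 - (1 - c') / (1 - c)) / 2"
      have \<kappa>: "\<kappa> > 0" unfolding \<kappa>_def using c cc by (intro divide_pos_pos mult_pos_pos) (auto simp: field_simps)
      have "\<alpha> / 2 > 0" using \<alpha> by simp
      from rank_test_power[OF Q contQ R contR ne[symmetric] \<kappa> this, where 'a='a]
      obtain C m0 where C: "\<forall>(M :: 'a measure) Y U m k. randomised_data M Y U m \<longrightarrow>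
        (\<forall>j\<in>{1..m}. distr M borel (Y j) = (if j \<le> k then Q else R)) \<longrightarrow> k \<le> m \<longrightarrow> m \<ge> 1 \<longrightarrow> m \<ge> m0 \<longrightarrow>
        \<kappa> \<le> (real k / real m) * (1 - real k / real m) \<longrightarrow>
        1 - C / real m \<le> measure M {\<omega>\<in>space M. randomised_data.rank_pvalue Y U m \<omega> \<le> \<alpha> / 2}"
        by (elim exE) (rule that)
      have lim': "(\<lambda>n. real (n - g n) / real n) \<longlonglongrightarrow> 1 - a"
        if g: "(\<lambda>n. real (g n) / real n) \<longlonglongrightarrow> a" and "eventually (\<lambda>n. g n \<le> n) sequentially" for g :: "nat \<Rightarrow> nat" and a
      proof -
        have "(\<lambda>n. 1 - real (g n) / real n) \<longlonglongrightarrow> 1 - a" using g by (intro tendsto_intros)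
        moreover have "eventually (\<lambda>n. 1 - real (g n) / real n = real (n - g n) / real n) sequentially"
          using that(2) eventually_gt_at_top[of 0] by eventually_elim (simp add: field_simps of_nat_diff)
        ultimately show ?thesis by (rule Lim_transform_eventually)
      qed
      have le: "eventually (\<lambda>n. t n \<le> n) sequentially" "eventually (\<lambda>n. t' n \<le> n) sequentially"
        using large by (eventually_elim, use tn in force)+
      note limr = lim'[OF lim(1) le(1)] lim'[OF lim(2) le(2)]
      have ev: "eventually (\<lambda>n. \<kappa> \<le> real (n - t' n) / real (n - t n) * (1 - real (n - t' n) / real (n - t n))) sequentially"
        "eventually (\<lambda>n. n - t n \<ge> m0) sequentially"
        using ratio[OF limr(2) limr(1), of m0] c cc by (auto simp: \<kappa>_def)
      have "eventually (\<lambda>n. 1 - C / real (n - t n) \<le> (\<integral>\<omega>. \<phi> n \<omega> \<partial>M n)) sequentially"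
        using ev large
      proof eventually_elim
        case (elim n)
        interpret prob_space "M n" using row[OF elim(3)] by (simp add: changepoint_row_def)
        have "t n \<le> t' n" unfolding t_def t'_def using cc by (intro cp_index_mono) simp
        moreover have "distr (M n) borel (X n (n + 1 - j)) = (if j \<le> n - t' n then Q else R)" if "j \<in> {1..n - t n}" for j
          using changepoint_row_distr_reversed[OF row[OF elim(3)], of j] that tn[OF elim(3)] \<tau> elim(3) by auto
        ultimately have "1 - C / real (n - t n) \<le> prob {\<omega>\<in>space (M n). pr n \<omega> \<le> \<alpha> / 2}"
          unfolding pr_def using tn[OF elim(3)] elim
          by (intro C[rule_format, where k="n - t' n"] randomised_data_right[OF row[OF elim(3)]]) auto
        also have "\<dots> \<le> prob ({\<omega>\<in>space (M n). pl n \<omega> \<le> \<alpha> / 2} \<union> {\<omega>\<in>space (M n). pr n \<omega> \<le> \<alpha> / 2})"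
          using meas[OF elim(3)] by (intro finite_measure_mono) auto
        finally show ?case by (simp add: int[OF elim(3)])
      qed
      then show ?thesis using limr(1) c by (intro conclude[of "\<lambda>n. n - t n" "1 - c" C]) auto
    qed
  qed
  show ?thesis
    using level power changepoint_condition_imp_distinct[OF assms(4,7,8)] by (intro conjI impI allI) simp_all
qed

end
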